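(* Let $m,n\geq 1$ and $L\geq 2$ be integers, let $d_0=n$, $d_L=m$ and $d_1,\dots,d_{L-1}\geq 1$, and let $W^{[l]}(t)\in\mathbb{R}^{d_{l+1}\times d_l}$, $l=0,\dots,L-1$, be factor matrices with end-to-end product $X(t)=W^{[L-1]}(t)W^{[L-2]}(t)\cdots W^{[0]}(t)\in\mathbb{R}^{m\times n}$. Assume the factors are balanced at initialization: $$\big[W^{[l+1]}(0)\big]^{\top}W^{[l+1]}(0)=W^{[l]}(0)\big[W^{[l]}(0)\big]^{\top},\qquad l=0,\dots,L-2 .$$ Let $\mathcal{L}_{\mathbb{Y}}:\mathbb{R}^{m\times n}\to\mathbb{R}$ be an analytic function, let $\lambda_r,\lambda_c\geq 0$, and let $L_r\in\mathbb{R}^{m\times m}$ and $L_c\in\mathbb{R}^{n\times n}$ be fixed Laplacian matrices obtained from the adaptive parameterization described in the context. Define $$\mathcal{L}(X)=\mathcal{L}_{\mathbb{Y}}(X)+\lambda_r\,\mathrm{tr}\big(X^{\top}L_rX\big)+\lambda_c\,\mathrm{tr}\big(XL_cX^{\top}\big),$$ and suppose the factors evolve by the gradient flow $$\dot W^{[l]}(t)=-\frac{\partial}{\partial W^{[l]}}\mathcal{L}(X(t)),\qquad t\geq 0,\quad l=0,\dots,L-1 .$$ Let $X(t)=U(t)S(t)V(t)^{\top}$ be an analytic singular value decomposition, let $\sigma_k(t)\geq 0$ be the $k$-th singular value (the $k$-th diagonal entry of $S(t)$), and let $u_k(t)$ and $v_k(t)$ be the corresponding left and right singular vectors (the $k$-th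 columns of $U(t)$ and $V(t)$), so that $X=\sum_s\sigma_s u_s v_s^{\top}$. Then for every $k=1,\dots,\min\{m,n\}$, $$\dot\sigma_k(t)=-L\big(\sigma_k^2(t)\big)^{1-\frac1L}\Big\langle \nabla_X\mathcal{L}_{\mathbb{Y}}(X(t)),\,u_k(t)v_k(t)^{\top}\Big\rangle-2L\big(\sigma_k^2(t)\big)^{\frac32-\frac1L}\gamma_k(t),$$ where $\gamma_k(t)=\lambda_r\,u_k(t)^{\top}L_ru_k(t)+\lambda_c\,v_k(t)^{\top}L_cv_k(t)\geq 0$ and $\langle\cdot,\cdot\rangle$ is the Frobenius inner product.
   Context: Adaptive Laplacian parameterization: for a size $p$ and a parameter matrix $W\in\mathbb{R}^{p\times p}$, set $A=\dfrac{\exp(W+W^{\top})}{\mathbf{1}_p^{\top}\exp(W)\mathbf{1}_p}$ (with $\exp$ applied entrywise and $\mathbf{1}_p$ the all-ones vector), which is symmetric with positive entries, and $L=\big(A\,\mathbf{1}_{p\times p}\big)\odot I_p-A$, i.e. $L=D-A$ with $D$ the diagonal degree matrix $D_{ii}=\sum_j A_{ij}$ ($\mathbf{1}_{p\times p}$ the all-ones matrix, $\odot$ the Hadamard product). $L_r$ is obtained this way with $p=m$ from a parameter $W_r\in\mathbb{R}^{m\times m}$, and $L_c$ with $p=n$ from a parameter $W_c\in\mathbb{R}^{n\times n}$; such Laplacians are symmetric positive semidefinite. The analytic SVD of $X(t)$ exists by analyticity of the loss (as in Arora et al.'s deep matrix factorization analysis). *)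

theory Defs
  imports "HOL-Analysis.Infinite_Sum" "HOL-Analysis.Derivative" "Jordan_Normal_Form.Matrix"
begin

text \<open>Matrices are Jordan_Normal_Form matrices (real mat), whose dimensions are part of
the value; this allows the layer widths d_l to vary with l.\<close>

definition analytic_on_nonneg :: "(real \<Rightarrow> real) \<Rightarrow> bool" where
  "analytic_on_nonneg f \<longleftrightarrow>
     (\<forall>t\<ge>0. \<exists>r>0. \<exists>c::nat \<Rightarrow> real.
        \<forall>s\<ge>0. \<bar>s - t\<bar> < r \<longrightarrow> (\<lambda>k. c k * (s - t) ^ k) sums f s)"

text \<open>Real-analytic function on the space of m x n real matrices: around every point it is
given by an (unconditionally, hence absolutely) convergent multivariate power series in the
m*n entries; multi-indices are functions alpha with alpha i j = 0 outside the index range.\<close>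
definition analytic_mat_fun :: "nat \<Rightarrow> nat \<Rightarrow> (real mat \<Rightarrow> real) \<Rightarrow> bool" where
  "analytic_mat_fun m n f \<longleftrightarrow>
     (\<forall>X \<in> carrier_mat m n. \<exists>r>0. \<exists>c::(nat \<Rightarrow> nat \<Rightarrow> nat) \<Rightarrow> real.
        \<forall>H \<in> carrier_mat m n. (\<forall>i<m. \<forall>j<n. \<bar>H $$ (i,j)\<bar> < r) \<longrightarrow>
          ((\<lambda>\<alpha>. c \<alpha> * (\<Prod>i<m. \<Prod>j<n. (H $$ (i,j)) ^ (\<alpha> i j))) has_sum f (X + H))
            {\<alpha>. \<forall>i j. (m \<le> i \<or> n \<le> j) \<longrightarrow> \<alpha> i j = 0})"

definition unit_entry_mat :: "nat \<Rightarrow> nat \<Rightarrow> nat \<Rightarrow> nat \<Rightarrow> real mat" where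
  "unit_entry_mat r c i j = mat r c (\<lambda>(a,b). if a = i \<and> b = j then 1 else 0)"

definition grad_mat :: "(real mat \<Rightarrow> real) \<Rightarrow> real mat \<Rightarrow> real mat" where
  "grad_mat f M = mat (dim_row M) (dim_col M)
     (\<lambda>(i,j). deriv (\<lambda>h. f (M + h \<cdot>\<^sub>m unit_entry_mat (dim_row M) (dim_col M) i j)) 0)"

definition frob_inner :: "real mat \<Rightarrow> real mat \<Rightarrow> real" where
  "frob_inner A B = (\<Sum>i<dim_row A. \<Sum>j<dim_col A. A $$ (i,j) * B $$ (i,j))"

definition outer_prod :: "real vec \<Rightarrow> real vec \<Rightarrow> real mat" where
  "outer_prod u v = mat (dim_vec u) (dim_vec v) (\<lambda>(i,j). u $ i * v $ j)"

fun prod_layers :: "(nat \<Rightarrow> real mat) \<Rightarrow> nat \<Rightarrow> nat \<Rightarrow> real mat" where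
  "prod_layers Ws n0 0 = 1\<^sub>m n0"
| "prod_layers Ws n0 (Suc k) = Ws k * prod_layers Ws n0 k"

definition adaptive_adj :: "nat \<Rightarrow> real mat \<Rightarrow> real mat" where
  "adaptive_adj p W = (1 / (\<Sum>i<p. \<Sum>j<p. exp (W $$ (i,j)))) \<cdot>\<^sub>m
       mat p p (\<lambda>(i,j). exp (W $$ (i,j) + W $$ (j,i)))"

definition adaptive_laplacian :: "nat \<Rightarrow> real mat \<Rightarrow> real mat" where
  "adaptive_laplacian p W =
     mat p p (\<lambda>(i,j). if i = j then (\<Sum>k<p. adaptive_adj p W $$ (i,k)) else 0) - adaptive_adj p W"

definition mat_trace :: "real mat \<Rightarrow> real" where
  "mat_trace A = (\<Sum>i<dim_row A. A $$ (i,i))"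

definition reg_loss :: "(real mat \<Rightarrow> real) \<Rightarrow> real \<Rightarrow> real \<Rightarrow> real mat \<Rightarrow> real mat \<Rightarrow> real mat \<Rightarrow> real" where
  "reg_loss LY lr lc Lr Lc X = LY X + lr * mat_trace (transpose_mat X * Lr * X)
                                 + lc * mat_trace (X * Lc * transpose_mat X)"

end

theory Submission
  imports Defs
begin

text \<open>
  Write \<open>X = R\<^sub>l Q\<^sub>l\<close> with \<open>Q\<^sub>l = W\<^sub>l\<^sub>-\<^sub>1 \<cdots> W\<^sub>0\<close> and \<open>R\<^sub>l = W\<^sub>L\<^sub>-\<^sub>1 \<cdots> W\<^sub>l\<close>, and let \<open>G\<close> be the gradient
  of the regularised loss at \<open>X\<close>. The flow reads \<open>W\<^sub>l' = - R\<^sub>l\<^sub>+\<^sub>1\<^sup>T G Q\<^sub>l\<^sup>T\<close>, so it conserves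
  \<open>W\<^sub>l\<^sub>+\<^sub>1\<^sup>T W\<^sub>l\<^sub>+\<^sub>1 - W\<^sub>l W\<^sub>l\<^sup>T\<close>, and the factors stay balanced. Balancedness gives
  \<open>R\<^sub>l R\<^sub>l\<^sup>T = A^(L-l)\<close> and \<open>Q\<^sub>l\<^sup>T Q\<^sub>l = B^l\<close> for the Gram matrices \<open>A = W\<^sub>L\<^sub>-\<^sub>1 W\<^sub>L\<^sub>-\<^sub>1\<^sup>T\<close> and
  \<open>B = W\<^sub>0\<^sup>T W\<^sub>0\<close>. Since \<open>A^L = X X\<^sup>T\<close> and \<open>B^L = X\<^sup>T X\<close>, the singular vectors \<open>u\<close> and \<open>v\<close> are
  eigenvectors of \<open>A\<close> and \<open>B\<close> with eigenvalue \<open>\<mu> = (\<sigma>\<^sup>2)^(1/L)\<close>. Each of the \<open>L\<close> terms of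
  \<open>X' = - (\<Sum>l. R\<^sub>l\<^sub>+\<^sub>1 R\<^sub>l\<^sub>+\<^sub>1\<^sup>T G Q\<^sub>l\<^sup>T Q\<^sub>l)\<close> therefore contributes \<open>- \<mu>^(L-1) (u \<bullet> G v)\<close> to
  \<open>u \<bullet> X' v\<close>, which is the derivative of \<open>\<sigma>\<close>.
\<close>

section \<open>Derivatives of analytic functions\<close>

text \<open>\<open>deriv\<close> is a choice operator and carries information only where a
  derivative exists, so an actual directional derivative is supplied. Pairing \<open>G\<close> with
  a unit matrix picks out one entry.\<close>

lemma grad_mat_eqI:
  assumes M: "M \<in> carrier_mat r c" and G: "G \<in> carrier_mat r c"
    and "\<And>H. H \<in> carrier_mat r c \<Longrightarrow>
      ((\<lambda>h. f (M + h \<cdot>\<^sub>m H)) has_real_derivative frob_inner G H) (at 0)"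
  shows "grad_mat f M = G"
proof (rule eq_matI)
  fix i j assume "i < dim_row G" "j < dim_col G"
  then have ij: "i < r" "j < c" using G by auto
  have E: "unit_entry_mat r c i j \<in> carrier_mat r c" by (simp add: unit_entry_mat_def)
  have "frob_inner G (unit_entry_mat r c i j)
      = (\<Sum>a<r. \<Sum>b<c. if b = j then (if a = i then G $$ (a,b) else 0) else 0)"
    unfolding frob_inner_def using G
    by (intro sum.cong) (auto simp: unit_entry_mat_def)
  also have "\<dots> = G $$ (i,j)" using ij by (simp add: sum.delta)
  finally show "grad_mat f M $$ (i,j) = G $$ (i,j)"
    using DERIV_imp_deriv[OF assms(3)[OF E]] M ij by (simp add: grad_mat_def)
qed (use M G in \<open>auto simp: grad_mat_def\<close>)

text \<open>Dividing by \<open>h\<close> leaves an error of at most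
  \<open>C * \<bar>h\<bar>\<close>. This turns a remainder estimate into a derivative without
  differentiating a multivariate series termwise.\<close>

lemma has_real_derivative_quadratic_error:
  fixes f :: "real \<Rightarrow> real"
  assumes "\<delta> > 0" and "\<And>h. \<bar>h\<bar> < \<delta> \<Longrightarrow> \<bar>f h - f 0 - h * D\<bar> \<le> C * h\<^sup>2"
  shows "(f has_real_derivative D) (at 0)"
proof -
  have "((\<lambda>h. (f h - f 0) / h - D) \<longlongrightarrow> 0) (at 0)"
  proof (rule Lim_null_comparison)
    show "\<forall>\<^sub>F h in at 0. norm ((f h - f 0) / h - D) \<le> C * \<bar>h\<bar>"
      unfolding eventually_at
    proof (intro exI conjI ballI impI)
      fix h :: real assume h: "h \<noteq> 0 \<and> dist h 0 < \<delta>"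
      then have "(f h - f 0) / h - D = (f h - f 0 - h * D) / h"
        by (simp add: field_simps)
      then have "norm ((f h - f 0) / h - D) = \<bar>f h - f 0 - h * D\<bar> / \<bar>h\<bar>"
        by simp
      also have "\<dots> \<le> C * h\<^sup>2 / \<bar>h\<bar>"
        using assms(2)[of h] h by (intro divide_right_mono) auto
      also have "\<dots> = C * \<bar>h\<bar>"
        using h by (simp add: power2_eq_square abs_if)
      finally show "norm ((f h - f 0) / h - D) \<le> C * \<bar>h\<bar>" .
    qed (use assms in auto)
    show "((\<lambda>h. C * \<bar>h\<bar>) \<longlongrightarrow> 0) (at (0::real))"
      by (auto intro!: tendsto_eq_intros)
  qed
  then show ?thesis
    unfolding DERIV_def using LIM_zero_cancel by fastforce
qed

text \<open>Used contrapositively: apart from the constant and the linear monomials, every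
  multi-index has degree at least 2.\<close>

lemma multi_index_degree_le_1:
  fixes \<alpha> :: "nat \<Rightarrow> nat \<Rightarrow> nat"
  assumes "\<forall>i j. (m \<le> i \<or> n \<le> j) \<longrightarrow> \<alpha> i j = 0" and "(\<Sum>i<m. \<Sum>j<n. \<alpha> i j) \<le> 1"
    and "\<alpha> \<noteq> (\<lambda>_ _. 0)"
  obtains a b where "a < m" "b < n" "\<alpha> = (\<lambda>i j. if i = a \<and> j = b then 1 else 0)"
proof -
  obtain a b where ab: "\<alpha> a b \<noteq> 0" using assms(3) by (meson ext)
  then have lt: "a < m" "b < n" using assms(1) by (meson not_le)+
  let ?P = "{..<m} \<times> {..<n}"
  have s: "(\<Sum>p\<in>?P. \<alpha> (fst p) (snd p)) \<le> 1"
    using assms(2) by (simp add: sum.cartesian_product case_prod_unfold)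
  have split: "(\<Sum>p\<in>?P. \<alpha> (fst p) (snd p)) = \<alpha> a b + (\<Sum>p\<in>?P - {(a,b)}. \<alpha> (fst p) (snd p))"
    using lt by (subst sum.remove[of _ "(a,b)"]) auto
  have one: "\<alpha> a b = 1" and zero: "(\<Sum>p\<in>?P - {(a,b)}. \<alpha> (fst p) (snd p)) = 0"
    using s split ab by linarith+
  have "\<alpha> i j = 0" if "(i,j) \<noteq> (a,b)" for i j
  proof (cases "i < m \<and> j < n")
    case True
    then have "(i,j) \<in> ?P - {(a,b)}" using that by auto
    moreover have "\<forall>p\<in>?P - {(a,b)}. \<alpha> (fst p) (snd p) = 0"
      using zero by (subst (asm) sum_eq_0_iff) auto
    ultimately have "\<alpha> (fst (i,j)) (snd (i,j)) = 0" by blast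
    then show ?thesis by simp
  next
    case False
    then show ?thesis using assms(1) by auto
  qed
  then have "\<alpha> = (\<lambda>i j. if i = a \<and> j = b then 1 else 0)"
    using one by (intro ext) auto
  then show ?thesis using lt that by blast
qed

text \<open>The series is cut at the finite set \<open>F\<close> of multi-indices of degree at most
  1. If all entries of \<open>H\<close> have absolute value at most \<rho> x with x \<le> 1, a
  monomial of degree at least 2 is bounded by x^2 times its value at the constant matrix \<rho>. So
  the tail is O(x^2) and the linear coefficients give the derivative.\<close>

lemma analytic_mat_fun_differentiable:
  assumes f: "analytic_mat_fun m n f" and X: "X \<in> carrier_mat m n"
  obtains g :: "nat \<Rightarrow> nat \<Rightarrow> real" where
    "\<And>H. H \<in> carrier_mat m n \<Longrightarrow>
       ((\<lambda>h. f (X + h \<cdot>\<^sub>m H)) has_real_derivative (\<Sum>i<m. \<Sum>j<n. g i j * H $$ (i,j))) (at 0)"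
proof -
  define A where "A = {\<alpha>::nat \<Rightarrow> nat \<Rightarrow> nat. \<forall>i j. (m \<le> i \<or> n \<le> j) \<longrightarrow> \<alpha> i j = 0}"
  define mono where "mono H \<alpha> = (\<Prod>i<m. \<Prod>j<n. (H $$ (i,j)) ^ (\<alpha> i j))"
    for H :: "real mat" and \<alpha> :: "nat \<Rightarrow> nat \<Rightarrow> nat"
  define deg where "deg \<alpha> = (\<Sum>i<m. \<Sum>j<n. \<alpha> i j)" for \<alpha> :: "nat \<Rightarrow> nat \<Rightarrow> nat"
  define e where "e p = (\<lambda>i j. if i = fst p \<and> j = snd p then 1 else (0::nat))" for p :: "nat \<times> nat"
  obtain r c where r: "r > 0" and c: "\<And>H. H \<in> carrier_mat m n \<Longrightarrow> (\<forall>i<m. \<forall>j<n. \<bar>H $$ (i,j)\<bar> < r)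
      \<Longrightarrow> ((\<lambda>\<alpha>. c \<alpha> * mono H \<alpha>) has_sum f (X + H)) A"
    using f X unfolding analytic_mat_fun_def A_def mono_def by blast
  \<comment> \<open>Half of \<open>r\<close> stays strictly inside the domain of convergence, so the
    constant matrix \<rho> is an admissible argument of the series.\<close>
  define \<rho> where "\<rho> = r / 2"
  have \<rho>: "\<rho> > 0" "\<rho> < r" using r by (auto simp: \<rho>_def)
  let ?P = "{..<m} \<times> {..<n}"
  let ?z = "\<lambda>_ _. 0 :: nat"
  define F where "F = insert ?z (e ` ?P)"
  have FA: "F \<subseteq> A" and finF: "finite F" by (auto simp: F_def A_def e_def)
  have inj: "inj_on e ?P"
  proof (rule inj_onI)
    fix p q assume "e p = e q"
    then have "e p (fst p) (snd p) = e q (fst p) (snd p)" by simp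
    then show "p = q" by (auto simp: e_def prod_eq_iff split: if_splits)
  qed
  have znot: "?z \<notin> e ` ?P"
  proof
    assume "?z \<in> e ` ?P"
    then obtain p where "?z = e p" by blast
    from fun_cong[OF fun_cong[OF this, of "fst p"], of "snd p"] show False by (simp add: e_def)
  qed
  have monoz: "mono H ?z = 1" for H by (simp add: mono_def)
  have monoe: "mono H (e p) = H $$ p" if "p \<in> ?P" for H p
  proof -
    have "mono H (e p) = (\<Prod>q\<in>?P. if q = p then H $$ q else 1)"
      unfolding mono_def e_def
      unfolding prod.cartesian_product by (intro prod.cong) auto
    also have "\<dots> = H $$ p" using that by (simp add: prod.delta)
    finally show ?thesis .
  qed
  have sumF: "(\<Sum>\<alpha>\<in>F. c \<alpha> * mono H \<alpha>) = c ?z + (\<Sum>i<m. \<Sum>j<n. c (e (i,j)) * H $$ (i,j))" for H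
  proof -
    have "(\<Sum>\<alpha>\<in>F. c \<alpha> * mono H \<alpha>) = c ?z + (\<Sum>\<alpha>\<in>e ` ?P. c \<alpha> * mono H \<alpha>)"
      unfolding F_def using znot by (simp add: monoz)
    also have "(\<Sum>\<alpha>\<in>e ` ?P. c \<alpha> * mono H \<alpha>) = (\<Sum>p\<in>?P. c (e p) * mono H (e p))"
      using sum.reindex[OF inj] by simp
    also have "\<dots> = (\<Sum>p\<in>?P. c (e p) * H $$ p)" by (intro sum.cong) (auto simp: monoe)
    also have "\<dots> = (\<Sum>i<m. \<Sum>j<n. c (e (i,j)) * H $$ (i,j))"
      by (simp add: sum.cartesian_product case_prod_unfold)
    finally show ?thesis .
  qed
  have deg2: "deg \<alpha> \<ge> 2" if "\<alpha> \<in> A - F" for \<alpha>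
  proof (rule ccontr)
    assume "\<not> deg \<alpha> \<ge> 2"
    then have "deg \<alpha> \<le> 1" by simp
    moreover have "\<alpha> \<noteq> ?z" and "\<alpha> \<in> A" using that by (auto simp: F_def)
    ultimately obtain a b where ab: "a < m" "b < n" "\<alpha> = (\<lambda>i j. if i = a \<and> j = b then 1 else 0)"
      using multi_index_degree_le_1[of m n \<alpha>] unfolding A_def deg_def by blast
    then have "\<alpha> = e (a,b)" by (simp add: e_def)
    then show False using that ab by (auto simp: F_def)
  qed
  define R where "R = mat m n (\<lambda>_. \<rho>)"
  have monoR: "mono R \<alpha> = \<rho> ^ deg \<alpha>" for \<alpha>
    by (simp add: mono_def R_def deg_def power_sum)
  have "((\<lambda>\<alpha>. c \<alpha> * mono R \<alpha>) has_sum f (X + R)) A"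
    using \<rho> by (intro c) (auto simp: R_def)
  then have "(\<lambda>\<alpha>. c \<alpha> * mono R \<alpha>) summable_on A - F"
    by (meson Diff_subset has_sum_imp_summable summable_on_subset_banach)
  \<comment> \<open>For real families unconditional summability is absolute summability; the series
    at the constant matrix \<rho> therefore yields a summable majorant of the whole tail.\<close>
  then have absR: "(\<lambda>\<alpha>. \<bar>c \<alpha>\<bar> * \<rho> ^ deg \<alpha>) summable_on A - F"
    using summable_on_iff_abs_summable_on_real[of "\<lambda>\<alpha>. c \<alpha> * mono R \<alpha>" "A - F"] \<rho>
    by (simp add: monoR abs_mult)
  define C where "C = (\<Sum>\<^sub>\<infinity>\<alpha>\<in>A - F. \<bar>c \<alpha>\<bar> * \<rho> ^ deg \<alpha>)"
  have rem: "\<bar>f (X + H) - c ?z - (\<Sum>i<m. \<Sum>j<n. c (e (i,j)) * H $$ (i,j))\<bar> \<le> C * x\<^sup>2"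
    if H: "H \<in> carrier_mat m n" and Hx: "\<And>i j. i < m \<Longrightarrow> j < n \<Longrightarrow> \<bar>H $$ (i,j)\<bar> \<le> \<rho> * x"
      and x: "0 \<le> x" "x \<le> 1" for H x
  proof -
    have "\<bar>H $$ (i,j)\<bar> < r" if "i < m" "j < n" for i j
    proof -
      have "\<rho> * x \<le> \<rho> * 1" using \<rho> x by (intro mult_left_mono) auto
      then show ?thesis using Hx[OF that] \<rho> by linarith
    qed
    then have hs: "((\<lambda>\<alpha>. c \<alpha> * mono H \<alpha>) has_sum f (X + H)) A"
      using H by (intro c) auto
    have hsF: "((\<lambda>\<alpha>. c \<alpha> * mono H \<alpha>) has_sum (\<Sum>\<alpha>\<in>F. c \<alpha> * mono H \<alpha>)) F"
      using finF by (rule has_sum_finite)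
    have hsd: "((\<lambda>\<alpha>. c \<alpha> * mono H \<alpha>) has_sum (f (X + H) - (\<Sum>\<alpha>\<in>F. c \<alpha> * mono H \<alpha>))) (A - F)"
      using has_sum_Diff[OF hs hsF FA] .
    have le: "\<bar>c \<alpha> * mono H \<alpha>\<bar> \<le> \<bar>c \<alpha>\<bar> * \<rho> ^ deg \<alpha> * x\<^sup>2" if "\<alpha> \<in> A - F" for \<alpha>
    proof -
      have "\<bar>mono H \<alpha>\<bar> = (\<Prod>i<m. \<Prod>j<n. \<bar>H $$ (i,j)\<bar> ^ (\<alpha> i j))"
        by (simp add: mono_def abs_prod power_abs)
      also have "\<dots> \<le> (\<Prod>i<m. \<Prod>j<n. (\<rho> * x) ^ (\<alpha> i j))"
        using Hx by (intro prod_mono conjI prod_nonneg power_mono) auto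
      also have "\<dots> = \<rho> ^ deg \<alpha> * x ^ deg \<alpha>"
        by (simp add: deg_def power_sum power_mult_distrib prod.distrib)
      also have "\<dots> \<le> \<rho> ^ deg \<alpha> * x\<^sup>2"
        using deg2[OF that] x \<rho> by (intro mult_left_mono power_decreasing) auto
      finally have "\<bar>c \<alpha>\<bar> * \<bar>mono H \<alpha>\<bar> \<le> \<bar>c \<alpha>\<bar> * (\<rho> ^ deg \<alpha> * x\<^sup>2)"
        by (intro mult_left_mono) auto
      then show ?thesis by (simp add: abs_mult mult.assoc)
    qed
    have hsb: "((\<lambda>\<alpha>. \<bar>c \<alpha>\<bar> * \<rho> ^ deg \<alpha> * x\<^sup>2) has_sum (C * x\<^sup>2)) (A - F)"
      unfolding C_def using absR by (intro has_sum_cmult_left has_sum_infsum)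
    have "f (X + H) - (\<Sum>\<alpha>\<in>F. c \<alpha> * mono H \<alpha>) \<le> C * x\<^sup>2"
      using hsd hsb by (rule has_sum_mono) (use le in \<open>force simp: abs_le_iff\<close>)
    moreover have "- (f (X + H) - (\<Sum>\<alpha>\<in>F. c \<alpha> * mono H \<alpha>)) \<le> C * x\<^sup>2"
    proof (rule has_sum_mono)
      show "((\<lambda>\<alpha>. - (c \<alpha> * mono H \<alpha>)) has_sum - (f (X + H) - (\<Sum>\<alpha>\<in>F. c \<alpha> * mono H \<alpha>))) (A - F)"
        using hsd by (simp only: has_sum_uminus minus_minus)
    qed (rule hsb, use le in \<open>force simp: abs_le_iff\<close>)
    ultimately show ?thesis unfolding sumF by linarith
  qed
  \<comment> \<open>The case \<open>H = 0\<close>, \<open>x = 0\<close> of the remainder estimate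
    identifies the constant coefficient.\<close>
  have f0: "f X = c ?z"
    using rem[of "0\<^sub>m m n" 0] X by auto
  show thesis
  proof (rule that[of "\<lambda>i j. c (e (i,j))"])
    fix H :: "real mat" assume H: "H \<in> carrier_mat m n"
    \<comment> \<open>A bound for all entries of \<open>H\<close>; the summand 1 keeps it positive
      when \<open>H\<close> vanishes, so that \<open>\<rho> / K\<close> is a valid step
      size.\<close>
    define K where "K = 1 + (\<Sum>p\<in>?P. \<bar>H $$ p\<bar>)"
    have K: "K > 0" by (simp add: K_def add_pos_nonneg sum_nonneg)
    have HK: "\<bar>H $$ (i,j)\<bar> \<le> K" if "i < m" "j < n" for i j
    proof -
      have "\<bar>H $$ (i,j)\<bar> \<le> (\<Sum>p\<in>?P. \<bar>H $$ p\<bar>)"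
        using that by (intro member_le_sum) auto
      then show ?thesis by (simp add: K_def)
    qed
    have X0: "X + 0 \<cdot>\<^sub>m H = X" using X H by (intro eq_matI) auto
    show "((\<lambda>h. f (X + h \<cdot>\<^sub>m H)) has_real_derivative
        (\<Sum>i<m. \<Sum>j<n. c (e (i,j)) * H $$ (i,j))) (at 0)"
    proof (rule has_real_derivative_quadratic_error)
      show "\<rho> / K > 0" using \<rho> K by simp
      fix h :: real assume h: "\<bar>h\<bar> < \<rho> / K"
      \<comment> \<open>Chosen so that the entries of \<open>h \<cdot>\<^sub>m H\<close> are at most
        \<rho> x; the bound on \<open>h\<close> makes x at most 1.\<close>
      define x where "x = \<bar>h\<bar> * K / \<rho>"
      have "\<bar>f (X + h \<cdot>\<^sub>m H) - c ?z - (\<Sum>i<m. \<Sum>j<n. c (e (i,j)) * (h \<cdot>\<^sub>m H) $$ (i,j))\<bar> \<le> C * x\<^sup>2"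
      proof (rule rem)
        show "0 \<le> x" using \<rho> K by (simp add: x_def)
        show "x \<le> 1" using h \<rho> K by (simp add: x_def field_simps)
        fix i j assume ij: "i < m" "j < n"
        then have "\<bar>(h \<cdot>\<^sub>m H) $$ (i,j)\<bar> = \<bar>h\<bar> * \<bar>H $$ (i,j)\<bar>" using H by (simp add: abs_mult)
        also have "\<dots> \<le> \<bar>h\<bar> * K" using HK[OF ij] by (intro mult_left_mono) auto
        also have "\<dots> = \<rho> * x" using \<rho> by (simp add: x_def)
        finally show "\<bar>(h \<cdot>\<^sub>m H) $$ (i,j)\<bar> \<le> \<rho> * x" .
      qed (use H in auto)
      moreover have "(\<Sum>i<m. \<Sum>j<n. c (e (i,j)) * (h \<cdot>\<^sub>m H) $$ (i,j))
          = h * (\<Sum>i<m. \<Sum>j<n. c (e (i,j)) * H $$ (i,j))"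
        using H by (simp add: sum_distrib_left mult.left_commute)
      moreover have "C * x\<^sup>2 = C * (K / \<rho>)\<^sup>2 * h\<^sup>2"
        by (simp add: x_def power_mult_distrib power_divide)
      ultimately show "\<bar>f (X + h \<cdot>\<^sub>m H) - f (X + 0 \<cdot>\<^sub>m H)
          - h * (\<Sum>i<m. \<Sum>j<n. c (e (i,j)) * H $$ (i,j))\<bar> \<le> C * (K / \<rho>)\<^sup>2 * h\<^sup>2"
        by (simp only: X0 f0)
    qed
  qed
qed

lemma analytic_mat_fun_directional_derivative:
  assumes f: "analytic_mat_fun m n f" and X: "X \<in> carrier_mat m n" and H: "H \<in> carrier_mat m n"
  shows "((\<lambda>h. f (X + h \<cdot>\<^sub>m H)) has_real_derivative frob_inner (grad_mat f X) H) (at 0)"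
proof -
  obtain g where g: "\<And>H. H \<in> carrier_mat m n \<Longrightarrow>
       ((\<lambda>h. f (X + h \<cdot>\<^sub>m H)) has_real_derivative (\<Sum>i<m. \<Sum>j<n. g i j * H $$ (i,j))) (at 0)"
    using analytic_mat_fun_differentiable[OF f X] by blast
  define G where "G = mat m n (\<lambda>(i,j). g i j)"
  have G: "G \<in> carrier_mat m n" by (simp add: G_def)
  have der: "((\<lambda>h. f (X + h \<cdot>\<^sub>m H)) has_real_derivative frob_inner G H) (at 0)"
    if "H \<in> carrier_mat m n" for H
    using g[OF that] by (simp add: frob_inner_def G_def)
  from der[OF H] grad_mat_eqI[OF X G der] show ?thesis by simp
qed

text \<open>The power series lives on both sides of \<open>t\<close> and is differentiated termwise
  there. It is tied to \<open>f\<close> at nonnegative arguments, which gives the derivative within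
  \<open>{0..}\<close>, one-sided at 0.\<close>

lemma analytic_on_nonneg_differentiable:
  assumes "analytic_on_nonneg f" "t \<ge> 0"
  obtains D where "(f has_real_derivative D) (at t within {0..})"
proof -
  obtain r c where r: "r > 0"
    and c: "\<And>s. s \<ge> 0 \<Longrightarrow> \<bar>s - t\<bar> < r \<Longrightarrow> (\<lambda>k. c k * (s - t) ^ k) sums f s"
    using assms unfolding analytic_on_nonneg_def by blast
  \<comment> \<open>The point \<open>t + K\<close> is nonnegative and within distance
    \<open>r\<close> of \<open>t\<close>, so the series converges at the positive radius
    \<open>K\<close>.\<close>
  define K where "K = r / 2"
  have K: "K > 0" using r by (simp add: K_def)
  have "summable (\<lambda>k. c k * K ^ k)"
    using c[of "t + K"] r assms(2) by (simp add: K_def sums_iff)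
  then have "((\<lambda>x. \<Sum>k. c k * x ^ k) has_real_derivative (\<Sum>k. diffs c k * 0 ^ k)) (at 0)"
    using K by (intro termdiffs_strong[of c K]) auto
  then have "((\<lambda>x. \<Sum>k. c k * x ^ k) has_real_derivative (\<Sum>k. diffs c k * 0 ^ k)) (at (t - t))"
    by simp
  moreover have "((\<lambda>s. s - t) has_real_derivative 1) (at t within {0..})"
    by (auto intro!: derivative_eq_intros)
  ultimately have "((\<lambda>s. \<Sum>k. c k * (s - t) ^ k) has_real_derivative
      (\<Sum>k. diffs c k * 0 ^ k) * 1) (at t within {0..})"
    by (rule DERIV_chain2)
  then have "((\<lambda>s. \<Sum>k. c k * (s - t) ^ k) has_real_derivative (\<Sum>k. diffs c k * 0 ^ k)) (at t within {0..})"
    by simp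
  then have "(f has_real_derivative (\<Sum>k. diffs c k * 0 ^ k)) (at t within {0..})"
  proof (rule has_field_derivative_transform_within[OF _ r])
    fix s assume "s \<in> {0..}" "dist s t < r"
    then show "(\<Sum>k. c k * (s - t) ^ k) = f s"
      using c[of s] by (simp add: sums_iff dist_real_def)
  qed (use assms in auto)
  then show ?thesis using that by blast
qed

section \<open>Frobenius inner product and traces\<close>

lemma mat_trace_mult:
  assumes "A \<in> carrier_mat r c" "B \<in> carrier_mat c r"
  shows "mat_trace (A * B) = (\<Sum>i<r. \<Sum>j<c. A $$ (i,j) * B $$ (j,i))"
  unfolding mat_trace_def using assms
  by (intro sum.cong) (auto simp: scalar_prod_def lessThan_atLeast0)

lemma mat_trace_comm:
  assumes "A \<in> carrier_mat r c" "B \<in> carrier_mat c r"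
  shows "mat_trace (A * B) = mat_trace (B * A)"
  unfolding mat_trace_mult[OF assms] mat_trace_mult[OF assms(2,1)]
  by (subst sum.swap) (simp add: mult.commute)

lemma frob_inner_eq_trace:
  assumes "A \<in> carrier_mat r c" "B \<in> carrier_mat r c"
  shows "frob_inner A B = mat_trace (transpose_mat A * B)"
proof -
  have "mat_trace (transpose_mat A * B) = (\<Sum>i<c. \<Sum>j<r. A $$ (j,i) * B $$ (j,i))"
    using assms by (subst mat_trace_mult[of _ c r]) auto
  also have "\<dots> = (\<Sum>j<r. \<Sum>i<c. A $$ (j,i) * B $$ (j,i))"
    by (rule sum.swap)
  finally show ?thesis using assms by (simp add: frob_inner_def)
qed

text \<open>The adjoint of the map \<open>H \<mapsto> R * H * Q\<close>, by cyclicity of the trace.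
  It carries the gradient at the end-to-end product back to a single layer.\<close>

lemma frob_inner_mult_transfer:
  assumes R: "R \<in> carrier_mat m p" and Q: "Q \<in> carrier_mat q n"
    and G: "G \<in> carrier_mat m n" and H: "H \<in> carrier_mat p q"
  shows "frob_inner G (R * H * Q) = frob_inner (transpose_mat R * G * transpose_mat Q) H"
proof -
  have t: "transpose_mat (transpose_mat R * G * transpose_mat Q) = Q * (transpose_mat G * R)"
    using assms by (subst transpose_mult[of _ p n _ q]) (auto simp: transpose_mult[of _ p m _ n])
  have "frob_inner (transpose_mat R * G * transpose_mat Q) H = mat_trace (Q * (transpose_mat G * R * H))"
    using assms by (subst frob_inner_eq_trace[of _ p q])
      (auto simp del: assoc_mult_mat simp: t assoc_mult_mat[of Q q n _ p H q])
  also have "\<dots> = mat_trace (transpose_mat G * R * H * Q)"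
    using assms by (intro mat_trace_comm[of _ q n]) auto
  also have "transpose_mat G * R * H * Q = transpose_mat G * (R * H * Q)"
    using assms by (simp add: assoc_mult_mat[of _ n m R p] assoc_mult_mat[of _ n m _ q Q n])
  also have "mat_trace \<dots> = frob_inner G (R * H * Q)"
    using assms by (subst frob_inner_eq_trace[of _ m n]) auto
  finally show ?thesis by simp
qed

lemma frob_inner_add_smult_left:
  assumes "A \<in> carrier_mat m n" "B \<in> carrier_mat m n" "H \<in> carrier_mat m n"
  shows "frob_inner (A + c \<cdot>\<^sub>m B) H = frob_inner A H + c * frob_inner B H"
  using assms by (simp add: frob_inner_def sum_distrib_left sum.distrib algebra_simps)

lemma trace_quadratic_expand:
  assumes "Y \<in> carrier_mat p q" "K \<in> carrier_mat p p"
  shows "mat_trace (transpose_mat Y * K * Y)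
    = (\<Sum>j<q. \<Sum>a<p. \<Sum>b<p. Y $$ (a,j) * K $$ (a,b) * Y $$ (b,j))"
proof -
  have "transpose_mat Y * K * Y = transpose_mat Y * (K * Y)"
    using assms by (intro assoc_mult_mat) auto
  then have "mat_trace (transpose_mat Y * K * Y)
      = (\<Sum>j<q. \<Sum>a<p. Y $$ (a,j) * (K * Y) $$ (a,j))"
    using assms by (simp add: mat_trace_mult[of _ q p])
  also have "\<dots> = (\<Sum>j<q. \<Sum>a<p. \<Sum>b<p. Y $$ (a,j) * K $$ (a,b) * Y $$ (b,j))"
    using assms
    by (intro sum.cong) (auto simp: scalar_prod_def lessThan_atLeast0 sum_distrib_left mult.assoc)
  finally show ?thesis .
qed

lemma trace_quadratic_directional_derivative:
  assumes X: "X \<in> carrier_mat p q" and H: "H \<in> carrier_mat p q"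
    and K: "K \<in> carrier_mat p p" and sym: "transpose_mat K = K"
  shows "((\<lambda>h. mat_trace (transpose_mat (X + h \<cdot>\<^sub>m H) * K * (X + h \<cdot>\<^sub>m H)))
    has_real_derivative 2 * frob_inner (K * X) H) (at 0)"
proof -
  have sym': "K $$ (a,b) = K $$ (b,a)" if "a < p" "b < p" for a b
    using that K sym by (metis carrier_matD index_transpose_mat(1))
  have ex: "mat_trace (transpose_mat (X + h \<cdot>\<^sub>m H) * K * (X + h \<cdot>\<^sub>m H))
    = (\<Sum>j<q. \<Sum>a<p. \<Sum>b<p. (X $$ (a,j) + h * H $$ (a,j)) * K $$ (a,b) * (X $$ (b,j) + h * H $$ (b,j)))" for h
    using X H K by (subst trace_quadratic_expand[of _ p q]) (auto intro!: sum.cong)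
  \<comment> \<open>The two cross terms of the expansion coincide since \<open>K\<close> is
    symmetric; this is the source of the factor 2.\<close>
  have sw: "(\<Sum>a<p. \<Sum>b<p. X $$ (a,j) * K $$ (a,b) * H $$ (b,j))
      = (\<Sum>a<p. \<Sum>b<p. H $$ (a,j) * K $$ (a,b) * X $$ (b,j))" for j
    by (subst sum.swap, intro sum.cong) (auto simp: sym')
  have "frob_inner (K * X) H = (\<Sum>j<q. \<Sum>a<p. \<Sum>b<p. H $$ (a,j) * K $$ (a,b) * X $$ (b,j))"
    unfolding frob_inner_def using X K
    by (subst sum.swap)
      (auto intro!: sum.cong simp: scalar_prod_def lessThan_atLeast0 sum_distrib_left algebra_simps)
  then have "2 * frob_inner (K * X) H = (\<Sum>j<q. \<Sum>a<p. \<Sum>b<p.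
      H $$ (a,j) * K $$ (a,b) * X $$ (b,j) + X $$ (a,j) * K $$ (a,b) * H $$ (b,j))"
    by (simp add: sum.distrib sw sum_distrib_left)
  then show ?thesis unfolding ex
    by (auto intro!: DERIV_sum derivative_eq_intros simp: sum.distrib algebra_simps)
qed

section \<open>The adaptive Laplacian\<close>

lemma adaptive_adj_carrier: "adaptive_adj p W \<in> carrier_mat p p"
  by (simp add: adaptive_adj_def)

lemma adaptive_adj_sym:
  "i < p \<Longrightarrow> j < p \<Longrightarrow> adaptive_adj p W $$ (i,j) = adaptive_adj p W $$ (j,i)"
  by (simp add: adaptive_adj_def add.commute)

lemma adaptive_adj_nonneg: "i < p \<Longrightarrow> j < p \<Longrightarrow> adaptive_adj p W $$ (i,j) \<ge> 0"
  by (simp add: adaptive_adj_def sum_nonneg)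

lemma adaptive_laplacian_carrier: "adaptive_laplacian p W \<in> carrier_mat p p"
  using adaptive_adj_carrier[of p W] by (simp add: adaptive_laplacian_def minus_carrier_mat)

lemma adaptive_laplacian_sym: "transpose_mat (adaptive_laplacian p W) = adaptive_laplacian p W"
  using adaptive_adj_carrier[of p W] adaptive_adj_sym[of _ p _ W]
  by (intro eq_matI) (auto simp: adaptive_laplacian_def)

text \<open>Twice the quadratic form is the sum of the terms
  \<open>A i j * (u $ i - u $ j)^2\<close>, whose weights are symmetric and nonnegative.\<close>

lemma adaptive_laplacian_psd:
  assumes u: "u \<in> carrier_vec p"
  shows "u \<bullet> (adaptive_laplacian p W *\<^sub>v u) \<ge> 0"
proof -
  define A where "A i j = adaptive_adj p W $$ (i,j)" for i j
  have entry: "adaptive_laplacian p W $$ (i,j) = (if i = j then (\<Sum>k<p. A i k) else 0) - A i j"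
    if "i < p" "j < p" for i j
    using that adaptive_adj_carrier[of p W] by (simp add: adaptive_laplacian_def A_def)
  have "u \<bullet> (adaptive_laplacian p W *\<^sub>v u)
      = (\<Sum>i<p. u $ i * (\<Sum>j<p. adaptive_laplacian p W $$ (i,j) * u $ j))"
    using u adaptive_laplacian_carrier[of p W]
    by (auto intro!: sum.cong simp: scalar_prod_def lessThan_atLeast0)
  also have "\<dots> = (\<Sum>i<p. u $ i * ((\<Sum>k<p. A i k) * u $ i - (\<Sum>j<p. A i j * u $ j)))"
  proof (intro sum.cong refl arg_cong2[of _ _ _ _ "(*)"])
    fix i assume i: "i \<in> {..<p}"
    have "(\<Sum>j<p. adaptive_laplacian p W $$ (i,j) * u $ j)
        = (\<Sum>j<p. (if i = j then (\<Sum>k<p. A i k) * u $ i else 0) - A i j * u $ j)"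
      using i by (intro sum.cong) (auto simp: entry algebra_simps)
    also have "\<dots> = (\<Sum>k<p. A i k) * u $ i - (\<Sum>j<p. A i j * u $ j)"
      using i by (simp add: sum_subtractf sum.delta)
    finally show "(\<Sum>j<p. adaptive_laplacian p W $$ (i,j) * u $ j)
        = (\<Sum>k<p. A i k) * u $ i - (\<Sum>j<p. A i j * u $ j)" .
  qed
  also have "\<dots> = (\<Sum>i<p. \<Sum>j<p. A i j * (u $ i)\<^sup>2) - (\<Sum>i<p. \<Sum>j<p. A i j * u $ i * u $ j)"
    by (simp add: sum_subtractf sum_distrib_left sum_distrib_right algebra_simps power2_eq_square)
  finally have e: "u \<bullet> (adaptive_laplacian p W *\<^sub>v u) = \<dots>" .
  have sw: "(\<Sum>i<p. \<Sum>j<p. A i j * (u $ j)\<^sup>2) = (\<Sum>i<p. \<Sum>j<p. A i j * (u $ i)\<^sup>2)"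
    by (subst sum.swap, intro sum.cong) (auto simp: A_def adaptive_adj_sym)
  have "0 \<le> (\<Sum>i<p. \<Sum>j<p. A i j * (u $ i - u $ j)\<^sup>2)"
    by (intro sum_nonneg mult_nonneg_nonneg) (auto simp: A_def adaptive_adj_nonneg)
  also have "\<dots> = (\<Sum>i<p. \<Sum>j<p. A i j * (u $ i)\<^sup>2 + A i j * (u $ j)\<^sup>2 - 2 * (A i j * u $ i * u $ j))"
    by (intro sum.cong refl) (simp add: power2_eq_square algebra_simps)
  also have "\<dots> = 2 * (u \<bullet> (adaptive_laplacian p W *\<^sub>v u))"
    unfolding e by (simp add: sum.distrib sum_subtractf sum_distrib_left[symmetric] sw)
  finally show ?thesis by simp
qed

section \<open>Eigenvectors of powers of Gram matrices\<close>

lemma pow_mat_mult_vec_shift: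
  assumes A: "A \<in> carrier_mat n n" and x: "x \<in> carrier_vec n"
  shows "(A ^\<^sub>m Suc i) *\<^sub>v x = (A ^\<^sub>m i) *\<^sub>v (A *\<^sub>v x)"
  using assms pow_carrier_mat[OF A, of i] by (simp add: assoc_mult_mat_vec[of _ n n])

lemma pow_mat_Suc_left:
  assumes A: "A \<in> carrier_mat n n"
  shows "A ^\<^sub>m Suc i = A * A ^\<^sub>m i"
proof (induction i)
  case 0
  then show ?case using A by simp
next
  case (Suc i)
  then show ?case
    using A pow_carrier_mat[OF A, of i] by (simp add: assoc_mult_mat[of _ n n _ n _ n])
qed

lemma scalar_prod_self_nonneg:
  fixes w :: "real vec"
  shows "w \<bullet> w \<ge> 0"
  by (simp add: scalar_prod_def sum_nonneg)

lemma symmetric_scalar_prod: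
  assumes A: "(A :: real mat) \<in> carrier_mat n n" and "transpose_mat A = A"
    and x: "x \<in> carrier_vec n" and y: "y \<in> carrier_vec n"
  shows "x \<bullet> (A *\<^sub>v y) = (A *\<^sub>v x) \<bullet> y"
  using transpose_vec_mult_scalar[OF A y x] assms(2) by simp

lemma gram_symmetric:
  assumes "(M :: real mat) \<in> carrier_mat n p"
  shows "transpose_mat (M * transpose_mat M) = M * transpose_mat M"
  using assms by (simp add: transpose_mult[of _ n p _ n])

text \<open>Induction in steps of two: symmetry moves one factor \<open>A\<close> to the left
  argument, so x . A^(i+2) x = (A x) . A^i (A x). The base cases are the squared norms of
  \<open>x\<close> and of \<open>transpose_mat M *\<^sub>v x\<close>.\<close>

lemma gram_power_scalar_nonneg:
  assumes M: "(M :: real mat) \<in> carrier_mat n p" and x: "x \<in> carrier_vec n"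
  shows "x \<bullet> ((M * transpose_mat M) ^\<^sub>m i *\<^sub>v x) \<ge> 0"
  using x
proof (induction i arbitrary: x rule: nat_induct2)
  case 0
  then show ?case using M by (simp add: scalar_prod_self_nonneg)
next
  case 1
  have "x \<bullet> (M * transpose_mat M *\<^sub>v x) = (transpose_mat M *\<^sub>v x) \<bullet> (transpose_mat M *\<^sub>v x)"
    using M 1 by (simp add: assoc_mult_mat_vec[of M n p] transpose_vec_mult_scalar[of M n p])
  then show ?case using M 1 by (simp add: scalar_prod_self_nonneg)
next
  case (step i)
  let ?A = "M * transpose_mat M"
  have A: "?A \<in> carrier_mat n n" using M by simp
  have Ai: "?A ^\<^sub>m i \<in> carrier_mat n n" using A by (rule pow_carrier_mat)
  have Ax: "?A *\<^sub>v x \<in> carrier_vec n" using A step by (metis mult_mat_vec_carrier)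
  have "?A ^\<^sub>m (i + 2) *\<^sub>v x = ?A *\<^sub>v (?A ^\<^sub>m i *\<^sub>v (?A *\<^sub>v x))"
    using pow_mat_mult_vec_shift[OF A step(2), of "Suc i"] pow_mat_Suc_left[OF A, of i]
      assoc_mult_mat_vec[OF A Ai Ax] by simp
  then have "x \<bullet> (?A ^\<^sub>m (i + 2) *\<^sub>v x) = (?A *\<^sub>v x) \<bullet> (?A ^\<^sub>m i *\<^sub>v (?A *\<^sub>v x))"
    using symmetric_scalar_prod[OF A gram_symmetric[OF M] step(2), of "?A ^\<^sub>m i *\<^sub>v (?A *\<^sub>v x)"] Ai Ax
    by (metis mult_mat_vec_carrier)
  then show ?case using step(1)[OF Ax] by simp
qed

text \<open>The factorisation A^N - \<mu>^N = (\<Sum>i<N. \<mu>^(N-1-i) A^i (A - \<mu>)), applied to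
  \<open>u\<close> and paired with \<open>y\<close>.\<close>

lemma pow_mat_telescope:
  assumes A: "(A :: real mat) \<in> carrier_mat n n" and u: "u \<in> carrier_vec n" and y: "y \<in> carrier_vec n"
  shows "y \<bullet> (A ^\<^sub>m N *\<^sub>v u) - \<mu> ^ N * (y \<bullet> u)
    = (\<Sum>i<N. \<mu> ^ (N - Suc i) * (y \<bullet> (A ^\<^sub>m i *\<^sub>v (A *\<^sub>v u - \<mu> \<cdot>\<^sub>v u))))"
proof (induction N)
  case 0
  then show ?case using A u by simp
next
  case (Suc N)
  let ?w = "A *\<^sub>v u - \<mu> \<cdot>\<^sub>v u"
  have AN: "A ^\<^sub>m N \<in> carrier_mat n n" using A by (rule pow_carrier_mat)
  have Au: "A *\<^sub>v u \<in> carrier_vec n" using A u by simp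
  have c: "A ^\<^sub>m N *\<^sub>v (A *\<^sub>v u) \<in> carrier_vec n" "A ^\<^sub>m N *\<^sub>v u \<in> carrier_vec n"
    using AN Au u by (metis mult_mat_vec_carrier)+
  have "A ^\<^sub>m N *\<^sub>v ?w = A ^\<^sub>m N *\<^sub>v (A *\<^sub>v u) - \<mu> \<cdot>\<^sub>v (A ^\<^sub>m N *\<^sub>v u)"
    using mult_minus_distrib_mat_vec[OF AN Au, of "\<mu> \<cdot>\<^sub>v u"] mult_mat_vec[OF AN u] u by simp
  then have st: "y \<bullet> (A ^\<^sub>m N *\<^sub>v ?w) = y \<bullet> (A ^\<^sub>m Suc N *\<^sub>v u) - \<mu> * (y \<bullet> (A ^\<^sub>m N *\<^sub>v u))"
    using c y unfolding pow_mat_mult_vec_shift[OF A u]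
    by (simp add: scalar_prod_minus_distrib[of _ n])
  have "(\<Sum>i<Suc N. \<mu> ^ (Suc N - Suc i) * (y \<bullet> (A ^\<^sub>m i *\<^sub>v ?w)))
     = (\<Sum>i<N. \<mu> * (\<mu> ^ (N - Suc i) * (y \<bullet> (A ^\<^sub>m i *\<^sub>v ?w)))) + y \<bullet> (A ^\<^sub>m N *\<^sub>v ?w)"
    by (simp add: Suc_diff_Suc[symmetric] mult.assoc[symmetric] power_Suc[symmetric] del: power_Suc)
  also have "\<dots> = \<mu> * (y \<bullet> (A ^\<^sub>m N *\<^sub>v u) - \<mu> ^ N * (y \<bullet> u)) + y \<bullet> (A ^\<^sub>m N *\<^sub>v ?w)"
    by (simp only: sum_distrib_left[symmetric] Suc.IH)
  also have "\<dots> = y \<bullet> (A ^\<^sub>m Suc N *\<^sub>v u) - \<mu> ^ Suc N * (y \<bullet> u)"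
    unfolding st by (simp add: algebra_simps)
  finally show ?case by simp
qed

lemma real_vec_eq_0_if_self_scalar_0:
  fixes w :: "real vec"
  assumes "w \<in> carrier_vec n" "w \<bullet> w = 0"
  shows "w = 0\<^sub>v n"
proof (rule eq_vecI)
  fix i assume i: "i < dim_vec (0\<^sub>v n :: real vec)"
  have "(\<Sum>i\<in>{0..<n}. w $ i * w $ i) = 0" using assms by (simp add: scalar_prod_def)
  then have "w $ i * w $ i = 0" using i by (subst (asm) sum_nonneg_eq_0_iff) auto
  then show "w $ i = 0\<^sub>v n $ i" using i by simp
qed (use assms in auto)

text \<open>If A (A z) = 0 and \<open>A\<close> is symmetric, then |A z|^2 = z . A (A z) = 0. With z
  = A^N u this lowers the exponent one by one.\<close>

lemma symmetric_power_kernel: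
  assumes A: "(A :: real mat) \<in> carrier_mat n n" and sym: "transpose_mat A = A"
    and u: "u \<in> carrier_vec n" and "A ^\<^sub>m Suc N *\<^sub>v u = 0\<^sub>v n"
  shows "A *\<^sub>v u = 0\<^sub>v n"
  using assms(4)
proof (induction N)
  case 0
  then show ?case using A u by simp
next
  case (Suc N)
  have AN: "A ^\<^sub>m N \<in> carrier_mat n n" using A by (rule pow_carrier_mat)
  define z where "z = A ^\<^sub>m N *\<^sub>v u"
  have z: "z \<in> carrier_vec n" using AN u unfolding z_def by (metis mult_mat_vec_carrier)
  have Az: "A *\<^sub>v z \<in> carrier_vec n" using A z by simp
  have s1: "A ^\<^sub>m Suc N *\<^sub>v u = A *\<^sub>v z"
    unfolding pow_mat_Suc_left[OF A] z_def using A AN u by (rule assoc_mult_mat_vec)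
  have "A ^\<^sub>m Suc (Suc N) *\<^sub>v u = A *\<^sub>v (A *\<^sub>v z)"
    unfolding pow_mat_Suc_left[OF A, of "Suc N"] s1[symmetric]
    using A pow_carrier_mat[OF A, of "Suc N"] u by (metis assoc_mult_mat_vec)
  then have "A *\<^sub>v (A *\<^sub>v z) = 0\<^sub>v n" using Suc by simp
  then have "(A *\<^sub>v z) \<bullet> (A *\<^sub>v z) = 0"
    using symmetric_scalar_prod[OF A sym z Az] z by simp
  then have "A *\<^sub>v z = 0\<^sub>v n" using real_vec_eq_0_if_self_scalar_0[OF Az] by simp
  then show ?case using Suc.IH s1 by simp
qed

text \<open>With \<open>w = A u - \<mu> u\<close>, the factorisation of \<open>A^N - \<mu>^N\<close> gives
  \<open>0 = (\<Sum>i<N. \<mu>^(N-1-i) * (w \<bullet> A^i w))\<close>, a sum of nonnegative terms; no spectral theorem is needed.\<close>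

lemma gram_power_eigenvector:
  assumes M: "(M :: real mat) \<in> carrier_mat n p" and u: "u \<in> carrier_vec n" and \<mu>: "\<mu> \<ge> 0" and N: "N > 0"
    and ev: "(M * transpose_mat M) ^\<^sub>m N *\<^sub>v u = \<mu> ^ N \<cdot>\<^sub>v u"
  shows "(M * transpose_mat M) *\<^sub>v u = \<mu> \<cdot>\<^sub>v u"
proof -
  define A where "A = M * transpose_mat M"
  have A: "A \<in> carrier_mat n n" using M by (simp add: A_def)
  obtain N' where N': "N = Suc N'" using N by (cases N) auto
  \<comment> \<open>For nonzero \<mu> the term i = 0, which is \<mu>^(N-1) |w|^2, forces w = 0. For
    \<mu> = 0 this coefficient may vanish, and the kernel of a power of a symmetric matrix is used
    instead.\<close>
  show ?thesis
  proof (cases "\<mu> = 0")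
    case True
    have "A ^\<^sub>m Suc N' *\<^sub>v u = 0\<^sub>v n"
      using ev u True N' by (auto simp: A_def)
    then have "A *\<^sub>v u = 0\<^sub>v n"
      using symmetric_power_kernel[OF A _ u] gram_symmetric[OF M] by (simp add: A_def)
    then show ?thesis using True u by (auto simp: A_def)
  next
    case False
    define w where "w = A *\<^sub>v u - \<mu> \<cdot>\<^sub>v u"
    have w: "w \<in> carrier_vec n" using A u by (simp add: w_def)
    have "0 = (\<Sum>i<N. \<mu> ^ (N - Suc i) * (w \<bullet> (A ^\<^sub>m i *\<^sub>v w)))"
      using pow_mat_telescope[OF A u w, of N \<mu>] ev u w unfolding w_def[symmetric] A_def[symmetric]
      by simp
    moreover have "w \<bullet> (A ^\<^sub>m i *\<^sub>v w) \<ge> 0" for i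
      using gram_power_scalar_nonneg[OF M w] by (simp add: A_def)
    ultimately have "\<forall>i\<in>{..<N}. \<mu> ^ (N - Suc i) * (w \<bullet> (A ^\<^sub>m i *\<^sub>v w)) = 0"
      using \<mu> by (subst sum_nonneg_eq_0_iff[symmetric]) auto
    from bspec[OF this, of 0] N False have "w \<bullet> w = 0" using A w by simp
    then have "w = 0\<^sub>v n" by (rule real_vec_eq_0_if_self_scalar_0[OF w])
    then have z: "(A *\<^sub>v u - \<mu> \<cdot>\<^sub>v u) $ i = 0" if "i < n" for i using that by (simp add: w_def)
    have "A *\<^sub>v u = \<mu> \<cdot>\<^sub>v u"
    proof (rule eq_vecI)
      fix i assume "i < dim_vec (\<mu> \<cdot>\<^sub>v u)"
      then have "i < n" using u by simp
      then show "(A *\<^sub>v u) $ i = (\<mu> \<cdot>\<^sub>v u) $ i" using z[of i] A u by simp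
    qed (use A u in auto)
    then show ?thesis by (simp add: A_def)
  qed
qed

lemma pow_mat_eigenvector:
  assumes A: "(A :: real mat) \<in> carrier_mat n n" and u: "u \<in> carrier_vec n" and "A *\<^sub>v u = \<mu> \<cdot>\<^sub>v u"
  shows "A ^\<^sub>m i *\<^sub>v u = \<mu> ^ i \<cdot>\<^sub>v u"
proof (induction i)
  case 0
  then show ?case using A u by simp
next
  case (Suc i)
  show ?case
    unfolding pow_mat_mult_vec_shift[OF A u] assms(3)
    using mult_mat_vec[OF pow_carrier_mat[OF A] u] Suc by (simp add: smult_smult_assoc)
qed

section \<open>Derivatives of matrix curves\<close>

text \<open>Entrywise, and one-sided at 0. The dimensions are required along the whole half-line
  because entries of products and transposes are expanded at points near \<open>t\<close> as
  well.\<close>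

definition has_mat_derivative :: "nat \<Rightarrow> nat \<Rightarrow> (real \<Rightarrow> real mat) \<Rightarrow> real mat \<Rightarrow> real \<Rightarrow> bool" where
  "has_mat_derivative r c F D t \<longleftrightarrow> t \<ge> 0 \<and> (\<forall>s\<ge>0. F s \<in> carrier_mat r c) \<and> D \<in> carrier_mat r c \<and>
     (\<forall>i<r. \<forall>j<c. ((\<lambda>s. F s $$ (i,j)) has_real_derivative D $$ (i,j)) (at t within {0..}))"

lemma has_mat_derivativeD:
  assumes "has_mat_derivative r c F D t" "i < r" "j < c"
  shows "((\<lambda>s. F s $$ (i,j)) has_real_derivative D $$ (i,j)) (at t within {0..})"
  using assms by (simp add: has_mat_derivative_def)

lemma has_mat_derivative_const:
  assumes "C \<in> carrier_mat r c" "t \<ge> 0"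
  shows "has_mat_derivative r c (\<lambda>_. C) (0\<^sub>m r c) t"
  using assms by (simp add: has_mat_derivative_def)

lemma has_mat_derivative_transpose:
  assumes "has_mat_derivative r c F D t"
  shows "has_mat_derivative c r (\<lambda>s. transpose_mat (F s)) (transpose_mat D) t"
  unfolding has_mat_derivative_def
proof (intro conjI allI impI)
  fix i j assume ij: "i < c" "j < r"
  have "((\<lambda>s. F s $$ (j,i)) has_real_derivative transpose_mat D $$ (i,j)) (at t within {0..})"
    using assms ij unfolding has_mat_derivative_def by auto
  then show "((\<lambda>s. transpose_mat (F s) $$ (i,j)) has_real_derivative transpose_mat D $$ (i,j)) (at t within {0..})"
    by (rule has_field_derivative_transform_within[where d = 1])
      (use assms ij in \<open>auto simp: has_mat_derivative_def\<close>)
qed (use assms in \<open>auto simp: has_mat_derivative_def\<close>)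

lemma has_mat_derivative_mult:
  assumes F: "has_mat_derivative r c F D t" and G: "has_mat_derivative c e G E t"
  shows "has_mat_derivative r e (\<lambda>s. F s * G s) (D * G t + F t * E) t"
  unfolding has_mat_derivative_def
proof (intro conjI allI impI)
  have t: "t \<ge> 0" using F by (simp add: has_mat_derivative_def)
  have dims: "F s \<in> carrier_mat r c" "G s \<in> carrier_mat c e" if "s \<ge> 0" for s
    using F G that by (auto simp: has_mat_derivative_def)
  have D: "D \<in> carrier_mat r c" and E: "E \<in> carrier_mat c e"
    using F G by (auto simp: has_mat_derivative_def)
  fix i j assume ij: "i < r" "j < e"
  have "((\<lambda>s. \<Sum>l<c. F s $$ (i,l) * G s $$ (l,j)) has_real_derivative
      (\<Sum>l<c. D $$ (i,l) * G t $$ (l,j) + F t $$ (i,l) * E $$ (l,j))) (at t within {0..})"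
    using ij by (auto intro!: DERIV_sum derivative_eq_intros has_mat_derivativeD[OF F] has_mat_derivativeD[OF G])
  also have "(\<Sum>l<c. D $$ (i,l) * G t $$ (l,j) + F t $$ (i,l) * E $$ (l,j)) = (D * G t + F t * E) $$ (i,j)"
    using dims[OF t] D E ij by (auto simp: scalar_prod_def lessThan_atLeast0 sum.distrib)
  finally show "((\<lambda>s. (F s * G s) $$ (i,j)) has_real_derivative (D * G t + F t * E) $$ (i,j)) (at t within {0..})"
  proof (rule has_field_derivative_transform_within[where d = 1])
    fix s :: real assume "s \<in> {0..}"
    then show "(\<Sum>l<c. F s $$ (i,l) * G s $$ (l,j)) = (F s * G s) $$ (i,j)"
      using dims[of s] ij by (auto simp: scalar_prod_def lessThan_atLeast0)
  qed (use t in auto)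
qed (use F G in \<open>auto simp: has_mat_derivative_def intro!: add_carrier_mat mult_carrier_mat\<close>)

text \<open>Each entry of the difference has derivative zero on the convex set \<open>{0..}\<close>
  and is therefore constant. This is how the flow yields a conserved quantity.\<close>

lemma mat_curves_eq_if_same_derivative:
  assumes F: "\<And>t. t \<ge> 0 \<Longrightarrow> has_mat_derivative r c F (D t) t"
    and G: "\<And>t. t \<ge> 0 \<Longrightarrow> has_mat_derivative r c G (D t) t"
    and "F 0 = G 0" and t: "t \<ge> 0"
  shows "F t = G t"
proof (rule eq_matI)
  have dims: "F s \<in> carrier_mat r c" "G s \<in> carrier_mat r c" if "s \<ge> 0" for s
    using F[OF that] G[OF that] that by (auto simp: has_mat_derivative_def)
  fix i j assume "i < dim_row (G t)" "j < dim_col (G t)"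
  then have ij: "i < r" "j < c" using dims[OF t] by auto
  have "((\<lambda>s. F s $$ (i,j) - G s $$ (i,j)) has_field_derivative 0) (at s within {0..})" if "s \<in> {0..}" for s
  proof -
    have "s \<ge> 0" using that by simp
    from DERIV_diff[OF has_mat_derivativeD[OF F[OF this] ij] has_mat_derivativeD[OF G[OF this] ij]]
    show ?thesis by simp
  qed
  then obtain k where k: "\<And>s. s \<in> {0..} \<Longrightarrow> F s $$ (i,j) - G s $$ (i,j) = k"
    using has_field_derivative_zero_constant[of "{0::real..}" "\<lambda>s. F s $$ (i,j) - G s $$ (i,j)"]
    by (metis convex_real_interval(1))
  from k[of 0] k[of t] t assms(3) show "F t $$ (i,j) = G t $$ (i,j)" by simp
next
  have "F t \<in> carrier_mat r c" "G t \<in> carrier_mat r c"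
    using F[OF t] G[OF t] t by (auto simp: has_mat_derivative_def)
  then show "dim_row (F t) = dim_row (G t)" "dim_col (F t) = dim_col (G t)" by auto
qed

section \<open>Products of layers\<close>

text \<open>Side conditions on \<open>dim_row\<close> and \<open>dim_col\<close> leave no
  intermediate dimension to guess when long products of varying widths are rewritten.\<close>

lemma mat_assoc_dim:
  "dim_col A = dim_row B \<Longrightarrow> dim_col B = dim_row C \<Longrightarrow> (A * B) * C = A * (B * (C :: real mat))"
  by (rule assoc_mult_mat[of A "dim_row A" "dim_col A" B "dim_col B" C "dim_col C"]) auto

lemma mat_vec_assoc_dim:
  "dim_col A = dim_row B \<Longrightarrow> dim_col B = dim_vec v \<Longrightarrow> (A * B) *\<^sub>v v = A *\<^sub>v (B *\<^sub>v (v :: real vec))"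
  by (rule assoc_mult_mat_vec[of A "dim_row A" "dim_col A" B "dim_col B"]) auto

lemma transpose_mult_dim:
  "dim_col A = dim_row B \<Longrightarrow> transpose_mat (A * B) = transpose_mat B * transpose_mat (A :: real mat)"
  by (rule transpose_mult[of A "dim_row A" "dim_col A" B "dim_col B"]) auto

text \<open>\<open>layers_above Ws mL L j\<close> is the product \<open>Ws (L - 1) * \<dots> * Ws (L - j)\<close> of the last \<open>j\<close> of \<open>L\<close> layers.\<close>

fun layers_above :: "(nat \<Rightarrow> real mat) \<Rightarrow> nat \<Rightarrow> nat \<Rightarrow> nat \<Rightarrow> real mat" where
  "layers_above Ws mL L 0 = 1\<^sub>m mL"
| "layers_above Ws mL L (Suc j) = layers_above Ws mL L j * Ws (L - Suc j)"

lemma layers_above_step: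
  assumes "l < L"
  shows "layers_above Ws mL L (L - l) = layers_above Ws mL L (L - Suc l) * Ws l"
proof -
  have "L - l = Suc (L - Suc l)" "L - Suc (L - Suc l) = l" using assms by auto
  then show ?thesis by simp
qed

lemma prod_layers_carrier:
  assumes "\<And>l. l < L \<Longrightarrow> Ws l \<in> carrier_mat (d (Suc l)) (d l)" and "k \<le> L"
  shows "prod_layers Ws (d 0) k \<in> carrier_mat (d k) (d 0)"
  using assms(2)
proof (induction k)
  case (Suc k)
  then show ?case using assms(1)[of k] by (auto intro!: mult_carrier_mat)
qed simp

lemma layers_above_carrier:
  assumes Ws: "\<And>l. l < L \<Longrightarrow> Ws l \<in> carrier_mat (d (Suc l)) (d l)" and "l \<le> L"
  shows "layers_above Ws (d L) L (L - l) \<in> carrier_mat (d L) (d l)"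
  using assms(2)
proof (induction l rule: inc_induct)
  case (step l)
  then show ?case using Ws[of l] by (auto simp: layers_above_step intro!: mult_carrier_mat)
qed simp

text \<open>Descending from \<open>l = L\<close>, each step moves the factor \<open>Ws l\<close>
  from the lower to the upper product.\<close>

lemma prod_layers_split:
  assumes Ws: "\<And>l. l < L \<Longrightarrow> Ws l \<in> carrier_mat (d (Suc l)) (d l)" and "l \<le> L"
  shows "prod_layers Ws (d 0) L = layers_above Ws (d L) L (L - l) * prod_layers Ws (d 0) l"
  using assms(2)
proof (induction l rule: inc_induct)
  case base
  then show ?case using prod_layers_carrier[of L Ws d L] Ws by simp
next
  case (step l)
  have "layers_above Ws (d L) L (L - Suc l) \<in> carrier_mat (d L) (d (Suc l))"
    "prod_layers Ws (d 0) l \<in> carrier_mat (d l) (d 0)"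
    using layers_above_carrier[of L Ws d "Suc l"] prod_layers_carrier[of L Ws d l] Ws step by auto
  then show ?case using step Ws[of l] by (simp add: layers_above_step mat_assoc_dim)
qed

lemma prod_layers_cong: "(\<And>q. q < k \<Longrightarrow> Ws q = Ws' q) \<Longrightarrow> prod_layers Ws n0 k = prod_layers Ws' n0 k"
  by (induction k) auto

lemma layers_above_cong:
  "(\<And>q. L - j \<le> q \<Longrightarrow> q < L \<Longrightarrow> Ws q = Ws' q) \<Longrightarrow> j \<le> L \<Longrightarrow> layers_above Ws mL L j = layers_above Ws' mL L j"
  by (induction j) auto

text \<open>Neither the product above layer \<open>l\<close> nor the one below it involves that
  layer, so the end-to-end product is linear in it.\<close>

lemma prod_layers_update:
  assumes Ws: "\<And>q. q < L \<Longrightarrow> Ws q \<in> carrier_mat (d (Suc q)) (d q)" and l: "l < L"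
    and M: "M \<in> carrier_mat (d (Suc l)) (d l)"
  shows "prod_layers (\<lambda>q. if q = l then M else Ws q) (d 0) L
    = layers_above Ws (d L) L (L - Suc l) * M * prod_layers Ws (d 0) l"
proof -
  let ?Ws = "\<lambda>q. if q = l then M else Ws q"
  have c: "?Ws q \<in> carrier_mat (d (Suc q)) (d q)" if "q < L" for q using Ws that M by auto
  have "prod_layers ?Ws (d 0) L = layers_above ?Ws (d L) L (L - l) * prod_layers ?Ws (d 0) l"
    using prod_layers_split[of L ?Ws d l] c l by simp
  also have "layers_above ?Ws (d L) L (L - l) = layers_above ?Ws (d L) L (L - Suc l) * M"
    using layers_above_step[OF l, of ?Ws] by simp
  also have "layers_above ?Ws (d L) L (L - Suc l) = layers_above Ws (d L) L (L - Suc l)"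
    using l by (intro layers_above_cong) auto
  also have "prod_layers ?Ws (d 0) l = prod_layers Ws (d 0) l"
    by (intro prod_layers_cong) auto
  finally show ?thesis .
qed

text \<open>The product rule in the recursion pattern of \<open>prod_layers\<close>, so that one
  induction builds the product and its derivative together.\<close>

fun prod_layers_deriv :: "(nat \<Rightarrow> real mat) \<Rightarrow> (nat \<Rightarrow> real mat) \<Rightarrow> nat \<Rightarrow> nat \<Rightarrow> real mat" where
  "prod_layers_deriv Ws Ds n0 0 = 0\<^sub>m n0 n0"
| "prod_layers_deriv Ws Ds n0 (Suc k) = Ds k * prod_layers Ws n0 k + Ws k * prod_layers_deriv Ws Ds n0 k"

lemma has_mat_derivative_prod_layers:
  assumes "\<And>l. l < L \<Longrightarrow> has_mat_derivative (d (Suc l)) (d l) (W l) (Ds l) t" and "t \<ge> 0" and "k \<le> L"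
  shows "has_mat_derivative (d k) (d 0) (\<lambda>s. prod_layers (\<lambda>q. W q s) (d 0) k)
    (prod_layers_deriv (\<lambda>q. W q t) Ds (d 0) k) t"
  using assms(3)
proof (induction k)
  case 0
  then show ?case using assms(2) by (simp add: has_mat_derivative_const)
next
  case (Suc k)
  then show ?case using has_mat_derivative_mult[OF assms(1)[of k]] by simp
qed

section \<open>Gram matrices of partial products of balanced factors\<close>

lemma balanced_prefix_intertwine:
  assumes Ws: "\<And>l. l < L \<Longrightarrow> Ws l \<in> carrier_mat (d (Suc l)) (d l)"
    and bal: "\<And>l. l + 2 \<le> L \<Longrightarrow> transpose_mat (Ws (Suc l)) * Ws (Suc l) = Ws l * transpose_mat (Ws l)"
    and "k < L"
  shows "transpose_mat (Ws k) * Ws k * prod_layers Ws (d 0) k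
    = prod_layers Ws (d 0) k * (transpose_mat (Ws 0) * Ws 0)"
  using assms(3)
proof (induction k)
  case 0
  then show ?case using Ws[of 0] by simp
next
  case (Suc k)
  let ?Q = "prod_layers Ws (d 0) k" and ?B = "transpose_mat (Ws 0) * Ws 0"
  have c: "Ws k \<in> carrier_mat (d (Suc k)) (d k)" "?Q \<in> carrier_mat (d k) (d 0)"
    "Ws 0 \<in> carrier_mat (d (Suc 0)) (d 0)"
    using Ws Suc prod_layers_carrier[of L Ws d k] by auto
  \<comment> \<open>Balancedness replaces the Gram matrix of layer \<open>Suc k\<close> by
    \<open>Ws k * transpose_mat (Ws k)\<close>; regrouping slides it past \<open>Ws k\<close> as the
    Gram matrix of layer \<open>k\<close>.\<close>
  have "transpose_mat (Ws (Suc k)) * Ws (Suc k) * prod_layers Ws (d 0) (Suc k)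
      = Ws k * (transpose_mat (Ws k) * Ws k * ?Q)"
    using bal[of k] Suc c by (simp add: mat_assoc_dim)
  also have "\<dots> = Ws k * (?Q * ?B)" using Suc by simp
  also have "\<dots> = prod_layers Ws (d 0) (Suc k) * ?B"
    using c by (simp add: mat_assoc_dim)
  finally show ?case .
qed

text \<open>A new layer inserts \<open>transpose_mat (Ws k) * Ws k\<close> between the two copies of
  the product; intertwining pushes it to the right end, where it becomes one more factor of the Gram
  matrix of layer 0.\<close>

lemma balanced_prefix_gram:
  assumes Ws: "\<And>l. l < L \<Longrightarrow> Ws l \<in> carrier_mat (d (Suc l)) (d l)"
    and bal: "\<And>l. l + 2 \<le> L \<Longrightarrow> transpose_mat (Ws (Suc l)) * Ws (Suc l) = Ws l * transpose_mat (Ws l)"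
    and L: "0 < L" and "k \<le> L"
  shows "transpose_mat (prod_layers Ws (d 0) k) * prod_layers Ws (d 0) k
    = (transpose_mat (Ws 0) * Ws 0) ^\<^sub>m k"
  using assms(4)
proof (induction k)
  case 0
  then show ?case using Ws[OF L] by simp
next
  case (Suc k)
  let ?Q = "prod_layers Ws (d 0) k" and ?B = "transpose_mat (Ws 0) * Ws 0"
  have c: "Ws k \<in> carrier_mat (d (Suc k)) (d k)" "?Q \<in> carrier_mat (d k) (d 0)"
    "Ws 0 \<in> carrier_mat (d (Suc 0)) (d 0)"
    using Ws L Suc prod_layers_carrier[of L Ws d k] by auto
  have "transpose_mat (prod_layers Ws (d 0) (Suc k)) * prod_layers Ws (d 0) (Suc k)
      = transpose_mat ?Q * (transpose_mat (Ws k) * Ws k * ?Q)"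
    using c by (simp add: mat_assoc_dim transpose_mult_dim)
  also have "\<dots> = transpose_mat ?Q * (?Q * ?B)"
    using balanced_prefix_intertwine[of L Ws d k] Ws bal Suc by simp
  also have "\<dots> = transpose_mat ?Q * ?Q * ?B"
    using c by (simp add: mat_assoc_dim)
  also have "\<dots> = ?B ^\<^sub>m Suc k" using Suc by simp
  finally show ?case .
qed

text \<open>Mirror image of the prefix case: balancedness moves the Gram matrix from right to left,
  up to the last layer.\<close>

lemma balanced_suffix_intertwine:
  assumes Ws: "\<And>l. l < L \<Longrightarrow> Ws l \<in> carrier_mat (d (Suc l)) (d l)"
    and bal: "\<And>l. l + 2 \<le> L \<Longrightarrow> transpose_mat (Ws (Suc l)) * Ws (Suc l) = Ws l * transpose_mat (Ws l)"
    and "j < L"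
  shows "layers_above Ws (d L) L j * (Ws (L - Suc j) * transpose_mat (Ws (L - Suc j)))
    = Ws (L - 1) * transpose_mat (Ws (L - 1)) * layers_above Ws (d L) L j"
  using assms(3)
proof (induction j)
  case 0
  then show ?case using Ws[of "L - 1"] by simp
next
  case (Suc j)
  \<comment> \<open>The layers in play are \<open>Suc l\<close> and \<open>l\<close>; naming the
    lower one hides the truncated subtraction, which is exact because
    \<open>Suc j < L\<close>.\<close>
  define l where "l = L - Suc (Suc j)"
  have l: "L - Suc j = Suc l" "Suc l < L" "L - Suc (Suc l) = j" using Suc by (auto simp: l_def)
  let ?R = "layers_above Ws (d L) L j" and ?A = "Ws (L - 1) * transpose_mat (Ws (L - 1))"
  have c: "Ws (Suc l) \<in> carrier_mat (d (Suc (Suc l))) (d (Suc l))" "Ws l \<in> carrier_mat (d (Suc l)) (d l)"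
    "?R \<in> carrier_mat (d L) (d (Suc (Suc l)))" "Ws (L - 1) \<in> carrier_mat (d L) (d (L - 1))"
    using Ws[of "Suc l"] Ws[of l] Ws[of "L - 1"] layers_above_carrier[of L Ws d "Suc (Suc l)"] Ws l by auto
  have "layers_above Ws (d L) L (Suc j) * (Ws l * transpose_mat (Ws l))
      = ?R * Ws (Suc l) * (transpose_mat (Ws (Suc l)) * Ws (Suc l))"
    using bal[of l] l by simp
  also have "\<dots> = ?R * (Ws (Suc l) * transpose_mat (Ws (Suc l))) * Ws (Suc l)"
    using c by (simp add: mat_assoc_dim)
  also have "\<dots> = ?A * ?R * Ws (Suc l)" using Suc l by simp
  also have "\<dots> = ?A * layers_above Ws (d L) L (Suc j)"
    using c l by (simp add: mat_assoc_dim)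
  finally show ?case by (simp add: l_def)
qed

text \<open>Here the inserted Gram matrix travels to the left end, so the power grows on the
  left.\<close>

lemma balanced_suffix_gram:
  assumes Ws: "\<And>l. l < L \<Longrightarrow> Ws l \<in> carrier_mat (d (Suc l)) (d l)"
    and bal: "\<And>l. l + 2 \<le> L \<Longrightarrow> transpose_mat (Ws (Suc l)) * Ws (Suc l) = Ws l * transpose_mat (Ws l)"
    and L: "0 < L" and "j \<le> L"
  shows "layers_above Ws (d L) L j * transpose_mat (layers_above Ws (d L) L j)
    = (Ws (L - 1) * transpose_mat (Ws (L - 1))) ^\<^sub>m j"
  using assms(4)
proof (induction j)
  case 0
  have "Ws (L - 1) \<in> carrier_mat (d L) (d (L - 1))" using Ws[of "L - 1"] L by simp
  then show ?case by simp
next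
  case (Suc j)
  define l where "l = L - Suc j"
  have l: "l < L" "L - Suc l = j" using Suc by (auto simp: l_def)
  let ?R = "layers_above Ws (d L) L j" and ?A = "Ws (L - 1) * transpose_mat (Ws (L - 1))"
  have c: "Ws l \<in> carrier_mat (d (Suc l)) (d l)" "?R \<in> carrier_mat (d L) (d (Suc l))"
    "Ws (L - 1) \<in> carrier_mat (d L) (d (L - 1))"
    using Ws[of l] Ws[of "L - 1"] layers_above_carrier[of L Ws d "Suc l"] Ws l by auto
  have A: "?A \<in> carrier_mat (d L) (d L)" using c by auto
  have "layers_above Ws (d L) L (Suc j) * transpose_mat (layers_above Ws (d L) L (Suc j))
      = ?R * (Ws l * transpose_mat (Ws l)) * transpose_mat ?R"
    using c by (simp add: l_def[symmetric] mat_assoc_dim transpose_mult_dim)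
  also have "\<dots> = ?A * ?R * transpose_mat ?R"
    using balanced_suffix_intertwine[of L Ws d j] Ws bal Suc by (simp add: l_def)
  also have "\<dots> = ?A * (?R * transpose_mat ?R)"
    using c by (simp add: mat_assoc_dim)
  also have "\<dots> = ?A ^\<^sub>m Suc j" using Suc pow_mat_Suc_left[OF A] by simp
  finally show ?case .
qed

section \<open>Gradient flow on the factors\<close>

lemma frob_inner_transpose:
  assumes "A \<in> carrier_mat r c" "B \<in> carrier_mat r c"
  shows "frob_inner (transpose_mat A) (transpose_mat B) = frob_inner A B"
  using assms unfolding frob_inner_def by (subst sum.swap) (auto intro!: sum.cong)

lemma reg_loss_directional_derivative:
  assumes LY: "analytic_mat_fun m n LY" and X: "X \<in> carrier_mat m n" and H: "H \<in> carrier_mat m n"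
    and Lr: "Lr \<in> carrier_mat m m" "transpose_mat Lr = Lr"
    and Lc: "Lc \<in> carrier_mat n n" "transpose_mat Lc = Lc"
  shows "((\<lambda>h. reg_loss LY lr lc Lr Lc (X + h \<cdot>\<^sub>m H)) has_real_derivative
    frob_inner (grad_mat LY X + (2 * lr) \<cdot>\<^sub>m (Lr * X) + (2 * lc) \<cdot>\<^sub>m (X * Lc)) H) (at 0)"
proof -
  have G: "grad_mat LY X \<in> carrier_mat m n" using X by (simp add: grad_mat_def)
  have T: "transpose_mat (X + h \<cdot>\<^sub>m H) = transpose_mat X + h \<cdot>\<^sub>m transpose_mat H" for h
    using X H by (intro eq_matI) auto
  \<comment> \<open>The column regulariser is a row regulariser of the transpose: tr(X Lc X^T) is
    the quadratic trace form of X^T with kernel \<open>Lc\<close>.\<close>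
  have "((\<lambda>h. mat_trace (transpose_mat (transpose_mat X + h \<cdot>\<^sub>m transpose_mat H) * Lc * (transpose_mat X + h \<cdot>\<^sub>m transpose_mat H)))
    has_real_derivative 2 * frob_inner (Lc * transpose_mat X) (transpose_mat H)) (at 0)"
    using X H Lc by (intro trace_quadratic_directional_derivative) auto
  moreover have "Lc * transpose_mat X = transpose_mat (X * Lc)"
    using X Lc by (simp add: transpose_mult_dim)
  moreover have "frob_inner (transpose_mat (X * Lc)) (transpose_mat H) = frob_inner (X * Lc) H"
    using X H Lc by (intro frob_inner_transpose) auto
  ultimately have c: "((\<lambda>h. mat_trace ((X + h \<cdot>\<^sub>m H) * Lc * transpose_mat (X + h \<cdot>\<^sub>m H)))
    has_real_derivative 2 * frob_inner (X * Lc) H) (at 0)"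
    by (simp add: T[symmetric])
  have e: "frob_inner (grad_mat LY X + (2 * lr) \<cdot>\<^sub>m (Lr * X) + (2 * lc) \<cdot>\<^sub>m (X * Lc)) H
    = frob_inner (grad_mat LY X) H + lr * (2 * frob_inner (Lr * X) H) + lc * (2 * frob_inner (X * Lc) H)"
  proof -
    have c: "Lr * X \<in> carrier_mat m n" "X * Lc \<in> carrier_mat m n" using X Lr Lc by auto
    then have "grad_mat LY X + (2 * lr) \<cdot>\<^sub>m (Lr * X) \<in> carrier_mat m n" using G by simp
    from frob_inner_add_smult_left[OF this c(2) H] frob_inner_add_smult_left[OF G c(1) H]
    show ?thesis by simp
  qed
  show ?thesis unfolding reg_loss_def e
    by (intro DERIV_add DERIV_cmult analytic_mat_fun_directional_derivative[OF LY X H]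
        trace_quadratic_directional_derivative[OF X H Lr] c)
qed

text \<open>Perturbing layer \<open>l\<close> by \<open>H\<close> changes the end-to-end product by
  exactly \<open>R * H * Q\<close>; the adjoint of this linear map carries \<open>G\<close> to the
  layer gradient.\<close>

lemma grad_mat_prod_layers:
  assumes Ws: "\<And>q. q < L \<Longrightarrow> Ws q \<in> carrier_mat (d (Suc q)) (d q)" and l: "l < L"
    and G: "G \<in> carrier_mat (d L) (d 0)"
    and f: "\<And>H. H \<in> carrier_mat (d L) (d 0) \<Longrightarrow>
      ((\<lambda>h. f (prod_layers Ws (d 0) L + h \<cdot>\<^sub>m H)) has_real_derivative frob_inner G H) (at 0)"
  shows "grad_mat (\<lambda>M. f (prod_layers (\<lambda>q. if q = l then M else Ws q) (d 0) L)) (Ws l)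
    = transpose_mat (layers_above Ws (d L) L (L - Suc l)) * G * transpose_mat (prod_layers Ws (d 0) l)"
proof (rule grad_mat_eqI)
  define R where "R = layers_above Ws (d L) L (L - Suc l)"
  define Q where "Q = prod_layers Ws (d 0) l"
  have R: "R \<in> carrier_mat (d L) (d (Suc l))" and Q: "Q \<in> carrier_mat (d l) (d 0)"
    using layers_above_carrier[of L Ws d "Suc l"] prod_layers_carrier[of L Ws d l] Ws l
    by (auto simp: R_def Q_def)
  show W: "Ws l \<in> carrier_mat (d (Suc l)) (d l)" using Ws l by simp
  show "transpose_mat (layers_above Ws (d L) L (L - Suc l)) * G * transpose_mat (prod_layers Ws (d 0) l)
      \<in> carrier_mat (d (Suc l)) (d l)"
    using R Q G unfolding R_def[symmetric] Q_def[symmetric] by (auto intro!: mult_carrier_mat)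
  have X: "prod_layers Ws (d 0) L = R * Ws l * Q"
    using prod_layers_split[of L Ws d l] Ws l layers_above_step[OF l, of Ws] by (simp add: R_def Q_def)
  fix H :: "real mat" assume H: "H \<in> carrier_mat (d (Suc l)) (d l)"
  have RHQ: "R * H * Q \<in> carrier_mat (d L) (d 0)" using R H Q by (auto intro!: mult_carrier_mat)
  have "R * (Ws l + h \<cdot>\<^sub>m H) * Q = R * Ws l * Q + h \<cdot>\<^sub>m (R * H * Q)" for h
  proof -
    have "R * (Ws l + h \<cdot>\<^sub>m H) = R * Ws l + h \<cdot>\<^sub>m (R * H)"
      using R W H by (simp add: mult_add_distrib_mat[of R "d L" "d (Suc l)"]
          mult_smult_distrib[of R "d L" "d (Suc l)"])
    moreover have "(R * Ws l + h \<cdot>\<^sub>m (R * H)) * Q = R * Ws l * Q + h \<cdot>\<^sub>m (R * H) * Q"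
      using R W H Q by (intro add_mult_distrib_mat[of _ "d L" "d l"]) auto
    moreover have "h \<cdot>\<^sub>m (R * H) * Q = h \<cdot>\<^sub>m (R * H * Q)"
      using R H Q by (intro mult_smult_assoc_mat[of _ "d L" "d l"]) auto
    ultimately show ?thesis by simp
  qed
  then have "prod_layers (\<lambda>q. if q = l then Ws l + h \<cdot>\<^sub>m H else Ws q) (d 0) L
      = prod_layers Ws (d 0) L + h \<cdot>\<^sub>m (R * H * Q)" for h
    using prod_layers_update[of L Ws d l "Ws l + h \<cdot>\<^sub>m H"] Ws l W H
    by (simp add: X R_def[symmetric] Q_def[symmetric])
  moreover have "frob_inner G (R * H * Q) = frob_inner (transpose_mat R * G * transpose_mat Q) H"
    using R Q G H by (rule frob_inner_mult_transfer)
  ultimately show "((\<lambda>h. f (prod_layers (\<lambda>q. if q = l then Ws l + h \<cdot>\<^sub>m H else Ws q) (d 0) L))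
      has_real_derivative frob_inner (transpose_mat (layers_above Ws (d L) L (L - Suc l)) * G
        * transpose_mat (prod_layers Ws (d 0) l)) H) (at 0)"
    using f[OF RHQ] by (simp add: R_def Q_def)
qed

text \<open>The negative gradient in layer \<open>l\<close> when \<open>G\<close> is the gradient of
  the loss at the end-to-end product. Keeping \<open>G\<close> arbitrary separates the algebra of
  the flow from the choice of loss.\<close>

definition layer_flow_field :: "(nat \<Rightarrow> real mat) \<Rightarrow> (nat \<Rightarrow> nat) \<Rightarrow> nat \<Rightarrow> real mat \<Rightarrow> nat \<Rightarrow> real mat" where
  "layer_flow_field Ws d L G l =
    - (transpose_mat (layers_above Ws (d L) L (L - Suc l)) * G * transpose_mat (prod_layers Ws (d 0) l))"

lemma mult_uminus_mat: "dim_col A = dim_row B \<Longrightarrow> A * (- B) = - (A * (B :: real mat))"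
  by (intro eq_matI) (auto simp: scalar_prod_def sum_negf)

lemma uminus_mult_mat: "dim_col A = dim_row B \<Longrightarrow> (- A) * B = - (A * (B :: real mat))"
  by (intro eq_matI) (auto simp: scalar_prod_def sum_negf)

text \<open>Both W_(l+1)^T W_(l+1)' and W_l' W_l^T equal Z = - W_(l+1)^T R^T G Q^T W_l^T, so the two
  sides have the same derivative Z^T + Z. Agreement at time 0 then persists, whatever the curve
  \<open>G\<close> is.\<close>

lemma balanced_conserved:
  assumes flow: "\<And>l t. l < L \<Longrightarrow> t \<ge> 0 \<Longrightarrow>
      has_mat_derivative (d (Suc l)) (d l) (W l) (layer_flow_field (\<lambda>q. W q t) d L (G t) l) t"
    and G: "\<And>t. t \<ge> 0 \<Longrightarrow> G t \<in> carrier_mat (d L) (d 0)"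
    and bal: "transpose_mat (W (Suc l) 0) * W (Suc l) 0 = W l 0 * transpose_mat (W l 0)"
    and l: "Suc l < L" and t: "t \<ge> 0"
  shows "transpose_mat (W (Suc l) t) * W (Suc l) t = W l t * transpose_mat (W l t)"
proof -
  have W: "W q s \<in> carrier_mat (d (Suc q)) (d q)" if "q < L" "s \<ge> 0" for q s
    using flow[OF that] that by (simp add: has_mat_derivative_def)
  define D where "D s q = layer_flow_field (\<lambda>q. W q s) d L (G s) q" for s q
  define Z where "Z s = D s l * transpose_mat (W l s)" for s
  have key: "transpose_mat (W (Suc l) s) * D s (Suc l) = Z s" if s: "s \<ge> 0" for s
  proof -
    define R where "R = layers_above (\<lambda>q. W q s) (d L) L (L - Suc (Suc l))"
    define Q where "Q = prod_layers (\<lambda>q. W q s) (d 0) l"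
    have c: "R \<in> carrier_mat (d L) (d (Suc (Suc l)))" "Q \<in> carrier_mat (d l) (d 0)"
      "W l s \<in> carrier_mat (d (Suc l)) (d l)" "W (Suc l) s \<in> carrier_mat (d (Suc (Suc l))) (d (Suc l))"
      "G s \<in> carrier_mat (d L) (d 0)"
      using layers_above_carrier[of L "\<lambda>q. W q s" d "Suc (Suc l)"]
        prod_layers_carrier[of L "\<lambda>q. W q s" d l] W l s G by (auto simp: R_def Q_def)
    have R': "layers_above (\<lambda>q. W q s) (d L) L (L - Suc l) = R * W (Suc l) s"
      using layers_above_step[OF l] by (simp add: R_def)
    show ?thesis
      unfolding Z_def D_def layer_flow_field_def R' R_def[symmetric] Q_def[symmetric] prod_layers.simps
      using c by (simp add: mult_uminus_mat uminus_mult_mat transpose_mult_dim mat_assoc_dim)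
  qed
  have Dc: "D s q \<in> carrier_mat (d (Suc q)) (d q)" if "q < L" "s \<ge> 0" for q s
    using flow[OF that] by (simp add: D_def has_mat_derivative_def)
  show ?thesis
  proof (rule mat_curves_eq_if_same_derivative[where D = "\<lambda>s. transpose_mat (Z s) + Z s"])
    fix s :: real assume s: "s \<ge> 0"
    have c: "D s l \<in> carrier_mat (d (Suc l)) (d l)" "D s (Suc l) \<in> carrier_mat (d (Suc (Suc l))) (d (Suc l))"
      "W l s \<in> carrier_mat (d (Suc l)) (d l)" "W (Suc l) s \<in> carrier_mat (d (Suc (Suc l))) (d (Suc l))"
      using Dc W l s by auto
    have d1: "has_mat_derivative (d (Suc l)) (d l) (W l) (D s l) s"
      and d2: "has_mat_derivative (d (Suc (Suc l))) (d (Suc l)) (W (Suc l)) (D s (Suc l)) s"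
      using flow[of l s] flow[of "Suc l" s] l s by (auto simp: D_def)
    have "transpose_mat (D s (Suc l)) * W (Suc l) s = transpose_mat (Z s)"
      unfolding key[OF s, symmetric] using c by (simp add: transpose_mult_dim)
    then show "has_mat_derivative (d (Suc l)) (d (Suc l)) (\<lambda>s. transpose_mat (W (Suc l) s) * W (Suc l) s)
        (transpose_mat (Z s) + Z s) s"
      using has_mat_derivative_mult[OF has_mat_derivative_transpose[OF d2] d2] key[OF s] by simp
    have "W l s * transpose_mat (D s l) = transpose_mat (Z s)"
      unfolding Z_def using c by (simp add: transpose_mult_dim)
    moreover have "Z s + transpose_mat (Z s) = transpose_mat (Z s) + Z s"
      unfolding Z_def using c by (intro comm_add_mat[of _ "d (Suc l)" "d (Suc l)"]) auto
    ultimately show "has_mat_derivative (d (Suc l)) (d (Suc l)) (\<lambda>s. W l s * transpose_mat (W l s))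
        (transpose_mat (Z s) + Z s) s"
      using has_mat_derivative_mult[OF d1 has_mat_derivative_transpose[OF d1]] by (simp add: Z_def)
  qed (use bal t in auto)
qed

text \<open>Induction on the number \<open>k\<close> of Leibniz terms collected. Multiplying by the
  layers above completes a partial derivative to an end-to-end matrix, and \<open>R * Ws k\<close>
  absorbs layer \<open>k\<close> into them. The dimension claim is carried along because the step
  uses it.\<close>

lemma layer_flow_bilinear:
  assumes Ws: "\<And>l. l < L \<Longrightarrow> Ws l \<in> carrier_mat (d (Suc l)) (d l)"
    and bal: "\<And>l. l + 2 \<le> L \<Longrightarrow> transpose_mat (Ws (Suc l)) * Ws (Suc l) = Ws l * transpose_mat (Ws l)"
    and G: "G \<in> carrier_mat (d L) (d 0)"
    and u: "u \<in> carrier_vec (d L)" and v: "v \<in> carrier_vec (d 0)"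
    and Au: "(Ws (L - 1) * transpose_mat (Ws (L - 1))) *\<^sub>v u = \<mu> \<cdot>\<^sub>v u"
    and Bv: "(transpose_mat (Ws 0) * Ws 0) *\<^sub>v v = \<mu> \<cdot>\<^sub>v v"
    and "k \<le> L"
  shows "u \<bullet> ((layers_above Ws (d L) L (L - k)
      * prod_layers_deriv Ws (layer_flow_field Ws d L G) (d 0) k) *\<^sub>v v)
    = - (real k * \<mu> ^ (L - 1) * (u \<bullet> (G *\<^sub>v v)))"
    and "prod_layers_deriv Ws (layer_flow_field Ws d L G) (d 0) k \<in> carrier_mat (d k) (d 0)"
  using assms(8)
proof (induction k)
  case 0
  case 1
  have "layers_above Ws (d L) L L \<in> carrier_mat (d L) (d 0)"
    using layers_above_carrier[of L Ws d 0] Ws by simp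
  moreover have "0\<^sub>m (d L) (d 0) *\<^sub>v v = 0\<^sub>v (d L)" using v by (intro eq_vecI) auto
  ultimately show ?case using u by simp
next
  case 0
  case 2
  then show ?case by simp
next
  case (Suc k)
  define R where "R = layers_above Ws (d L) L (L - Suc k)"
  define Q where "Q = prod_layers Ws (d 0) k"
  define P where "P = prod_layers_deriv Ws (layer_flow_field Ws d L G) (d 0) k"
  have c: "R \<in> carrier_mat (d L) (d (Suc k))" "Q \<in> carrier_mat (d k) (d 0)"
    "Ws k \<in> carrier_mat (d (Suc k)) (d k)" "P \<in> carrier_mat (d k) (d 0)" if "Suc k \<le> L"
    using layers_above_carrier[of L Ws d "Suc k"] prod_layers_carrier[of L Ws d k] Ws that Suc.IH(2)
    by (auto simp: R_def Q_def P_def)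
  have pd: "prod_layers_deriv Ws (layer_flow_field Ws d L G) (d 0) (Suc k)
      = - (transpose_mat R * G * transpose_mat Q) * Q + Ws k * P"
    by (simp add: R_def Q_def P_def layer_flow_field_def)
  {
    case 2
    then show ?case unfolding pd using c G by (auto intro!: add_carrier_mat mult_carrier_mat)
  next
    case 1
    note c = c[OF 1]
    have L: "0 < L" using 1 by simp
    let ?A = "Ws (L - 1) * transpose_mat (Ws (L - 1))" and ?B = "transpose_mat (Ws 0) * Ws 0"
    have Ac: "?A \<in> carrier_mat (d L) (d L)" using Ws[of "L - 1"] L by auto
    have Bc: "?B \<in> carrier_mat (d 0) (d 0)" using Ws[of 0] L by auto
    have RR: "R * transpose_mat R = ?A ^\<^sub>m (L - Suc k)"
      using balanced_suffix_gram[of L Ws d "L - Suc k"] Ws bal L by (simp add: R_def)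
    have QQ: "transpose_mat Q * Q = ?B ^\<^sub>m k"
      using balanced_prefix_gram[of L Ws d k] Ws bal L 1 by (simp add: Q_def)
    have Rw: "R * Ws k = layers_above Ws (d L) L (L - k)"
      using layers_above_step[of k L Ws] 1 by (simp add: R_def)
    have split: "R * (- (transpose_mat R * G * transpose_mat Q) * Q + Ws k * P)
        = - (R * transpose_mat R * (G * (transpose_mat Q * Q))) + R * Ws k * P"
    proof -
      have "R * (- (transpose_mat R * G * transpose_mat Q) * Q + Ws k * P)
          = R * (- (transpose_mat R * G * transpose_mat Q) * Q) + R * (Ws k * P)"
        using c G by (intro mult_add_distrib_mat[of _ "d L" "d (Suc k)"]) auto
      then show ?thesis using c G by (simp add: mult_uminus_mat uminus_mult_mat mat_assoc_dim)
    qed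
    define Y where "Y = G *\<^sub>v (transpose_mat Q * Q *\<^sub>v v)"
    have Yc: "Y \<in> carrier_vec (d L)" using G c v by (auto simp: Y_def intro!: mult_mat_vec_carrier)
    have "u \<bullet> ((R * transpose_mat R * (G * (transpose_mat Q * Q))) *\<^sub>v v)
        = u \<bullet> (R * transpose_mat R *\<^sub>v Y)"
      using c G v by (simp add: Y_def mat_vec_assoc_dim)
    \<comment> \<open>Moving the symmetric matrix \<open>R * transpose_mat R\<close> onto
      \<open>u\<close> lets both eigenvector relations act, one on each side of
      \<open>G\<close>.\<close>
    also have "\<dots> = (R * transpose_mat R *\<^sub>v u) \<bullet> Y"
      using symmetric_scalar_prod[OF _ gram_symmetric[OF c(1)] u Yc] c by simp
    also have "R * transpose_mat R *\<^sub>v u = \<mu> ^ (L - Suc k) \<cdot>\<^sub>v u"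
      unfolding RR using pow_mat_eigenvector[OF Ac u Au] .
    also have "Y = \<mu> ^ k \<cdot>\<^sub>v (G *\<^sub>v v)"
      unfolding Y_def QQ pow_mat_eigenvector[OF Bc v Bv] using G v by (rule mult_mat_vec)
    \<comment> \<open>The exponents L-1-k and k add up to L-1, so every layer contributes the same
      amount.\<close>
    also have "(\<mu> ^ (L - Suc k) \<cdot>\<^sub>v u) \<bullet> (\<mu> ^ k \<cdot>\<^sub>v (G *\<^sub>v v)) = \<mu> ^ (L - 1) * (u \<bullet> (G *\<^sub>v v))"
    proof -
      have "G *\<^sub>v v \<in> carrier_vec (d L)" using G v by simp
      moreover have "\<mu> ^ (L - 1) = \<mu> ^ (L - Suc k) * \<mu> ^ k"
        using 1 by (simp add: power_add[symmetric])
      ultimately show ?thesis using u by simp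
    qed
    finally have main: "u \<bullet> ((R * transpose_mat R * (G * (transpose_mat Q * Q))) *\<^sub>v v)
        = \<mu> ^ (L - 1) * (u \<bullet> (G *\<^sub>v v))" .
    define E where "E = R * transpose_mat R * (G * (transpose_mat Q * Q))"
    have Ec: "E \<in> carrier_mat (d L) (d 0)" using c G by (auto simp: E_def intro!: mult_carrier_mat)
    have RPc: "R * Ws k * P \<in> carrier_mat (d L) (d 0)" using c by (auto intro!: mult_carrier_mat)
    have "(- E + R * Ws k * P) *\<^sub>v v = - (E *\<^sub>v v) + (R * Ws k * P) *\<^sub>v v"
      using Ec RPc v by (subst add_mult_distrib_mat_vec[of _ "d L" "d 0"])
        (auto intro!: eq_vecI simp: scalar_prod_def sum_negf)
    then have "u \<bullet> ((- E + R * Ws k * P) *\<^sub>v v) = - (u \<bullet> (E *\<^sub>v v)) + u \<bullet> ((R * Ws k * P) *\<^sub>v v)"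
      using Ec RPc v u by (simp add: scalar_prod_add_distrib[of _ "d L"] mult_mat_vec_carrier[of _ "d L" "d 0"])
    also have "u \<bullet> ((R * Ws k * P) *\<^sub>v v) = - (real k * \<mu> ^ (L - 1) * (u \<bullet> (G *\<^sub>v v)))"
      unfolding Rw P_def using Suc.IH(1) 1 by simp
    finally show ?case
      unfolding pd R_def[symmetric] split E_def[symmetric]
      using main by (simp add: E_def[symmetric] algebra_simps)
  }
qed

text \<open>The diagonal entry of \<open>transpose_mat (U s) * U s\<close> is constantly 1, and its
  derivative is twice this scalar product.\<close>

lemma orthonormal_col_derivative:
  assumes U: "has_mat_derivative p p U U' t" and orth: "\<And>s. s \<ge> 0 \<Longrightarrow> transpose_mat (U s) * U s = 1\<^sub>m p"
    and k: "k < p"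
  shows "col U' k \<bullet> col (U t) k = 0"
proof -
  have t: "t \<ge> 0" and c: "U t \<in> carrier_mat p p" "U' \<in> carrier_mat p p"
    using U by (auto simp: has_mat_derivative_def)
  have "((\<lambda>s. (transpose_mat (U s) * U s) $$ (k,k)) has_real_derivative
      (transpose_mat U' * U t + transpose_mat (U t) * U') $$ (k,k)) (at t within {0..})"
    using has_mat_derivative_mult[OF has_mat_derivative_transpose[OF U] U] k
    by (rule has_mat_derivativeD) (rule k)
  then have "((\<lambda>s. 1) has_real_derivative
      (transpose_mat U' * U t + transpose_mat (U t) * U') $$ (k,k)) (at t within {0..})"
    by (rule has_field_derivative_transform_within[where d = 1]) (use t k in \<open>auto simp: orth\<close>)
  moreover have "((\<lambda>s. 1) has_real_derivative 0) (at t within {0..})" by simp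
  \<comment> \<open>Uniqueness of the derivative within \<open>{0..}\<close> requires
    \<open>t\<close> to be a limit point; the right-hand neighbourhood shows this also at t =
    0.\<close>
  moreover have "at t within {0..} \<noteq> bot"
  proof -
    have "{t<..} \<subseteq> {0..}" using t by auto
    from at_le[OF this, of t] trivial_limit_at_right_real[of t] show ?thesis by (metis le_bot)
  qed
  ultimately have "(transpose_mat U' * U t + transpose_mat (U t) * U') $$ (k,k) = 0"
    by (metis has_real_derivative_iff_has_vector_derivative vector_derivative_unique_within)
  moreover have "(transpose_mat U' * U t + transpose_mat (U t) * U') $$ (k,k)
      = col U' k \<bullet> col (U t) k + col (U t) k \<bullet> col U' k"
    using c k by simp
  moreover have "col (U t) k \<bullet> col U' k = col U' k \<bullet> col (U t) k"
    using c k by (intro comm_scalar_prod[of _ p]) auto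
  ultimately show ?thesis by simp
qed

section \<open>Evolution of the singular values\<close>

lemma analytic_has_mat_derivative:
  assumes F: "\<And>s. s \<ge> 0 \<Longrightarrow> F s \<in> carrier_mat r c"
    and an: "\<And>i j. i < r \<Longrightarrow> j < c \<Longrightarrow> analytic_on_nonneg (\<lambda>s. F s $$ (i,j))" and t: "t \<ge> 0"
  obtains D where "has_mat_derivative r c F D t"
proof -
  have "\<exists>D. ((\<lambda>s. F s $$ (i,j)) has_real_derivative D) (at t within {0..})" if "i < r" "j < c" for i j
    using analytic_on_nonneg_differentiable[OF an[OF that] t] by blast
  then obtain D where "\<And>i j. i < r \<Longrightarrow> j < c \<Longrightarrow>
      ((\<lambda>s. F s $$ (i,j)) has_real_derivative D i j) (at t within {0..})"
    by metis
  then have "has_mat_derivative r c F (mat r c (\<lambda>(i,j). D i j)) t"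
    using F t by (simp add: has_mat_derivative_def)
  then show ?thesis by (rule that)
qed

text \<open>The k-th columns of X V = U S and X^T U = V S^T have a single surviving term. The third
  conclusion writes the singular values as entries of a product of curves that can be
  differentiated.\<close>

lemma svd_singular_vectors:
  assumes U: "(U :: real mat) \<in> carrier_mat m m" and S: "S \<in> carrier_mat m n" and V: "V \<in> carrier_mat n n"
    and Uo: "transpose_mat U * U = 1\<^sub>m m" and Vo: "transpose_mat V * V = 1\<^sub>m n"
    and diag: "\<And>i j. i < m \<Longrightarrow> j < n \<Longrightarrow> i \<noteq> j \<Longrightarrow> S $$ (i,j) = 0"
    and X: "X = U * S * transpose_mat V" and k: "k < min m n"
  shows "X *\<^sub>v col V k = S $$ (k,k) \<cdot>\<^sub>v col U k"
    and "transpose_mat X *\<^sub>v col U k = S $$ (k,k) \<cdot>\<^sub>v col V k"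
    and "transpose_mat U * (X * V) = S"
proof -
  have XV: "X * V = U * S"
    using U S V Vo by (simp add: X mat_assoc_dim)
  show "transpose_mat U * (X * V) = S"
    unfolding XV using U S Uo by (simp add: mat_assoc_dim[symmetric])
  have XU: "transpose_mat X * U = V * transpose_mat S"
    using U S V Uo by (simp add: X mat_assoc_dim transpose_mult_dim)
  have "X *\<^sub>v col V k = col (X * V) k"
    using U S V k by (intro eq_vecI) (auto simp: X)
  also have "\<dots> = S $$ (k,k) \<cdot>\<^sub>v col U k"
  proof (rule eq_vecI)
    fix i assume "i < dim_vec (S $$ (k,k) \<cdot>\<^sub>v col U k)"
    then have i: "i < m" using U by simp
    have "col (X * V) k $ i = (\<Sum>j\<in>{0..<m}. U $$ (i,j) * S $$ (j,k))"
      unfolding XV using U S i k by (simp add: scalar_prod_def)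
    also have "\<dots> = (\<Sum>j\<in>{0..<m}. if j = k then U $$ (i,k) * S $$ (k,k) else 0)"
      using diag k by (intro sum.cong) auto
    also have "\<dots> = (S $$ (k,k) \<cdot>\<^sub>v col U k) $ i" using U i k by simp
    finally show "col (X * V) k $ i = (S $$ (k,k) \<cdot>\<^sub>v col U k) $ i" .
  qed (use XV U in auto)
  finally show "X *\<^sub>v col V k = S $$ (k,k) \<cdot>\<^sub>v col U k" .
  have "transpose_mat X *\<^sub>v col U k = col (transpose_mat X * U) k"
    using U S V k by (intro eq_vecI) (auto simp: X)
  also have "\<dots> = S $$ (k,k) \<cdot>\<^sub>v col V k"
  proof (rule eq_vecI)
    fix i assume "i < dim_vec (S $$ (k,k) \<cdot>\<^sub>v col V k)"
    then have i: "i < n" using V by simp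
    have "col (transpose_mat X * U) k $ i = (\<Sum>j\<in>{0..<n}. V $$ (i,j) * S $$ (k,j))"
      unfolding XU using V S i k by (simp add: scalar_prod_def)
    also have "\<dots> = (\<Sum>j\<in>{0..<n}. if j = k then V $$ (i,k) * S $$ (k,k) else 0)"
      using diag k by (intro sum.cong) auto
    also have "\<dots> = (S $$ (k,k) \<cdot>\<^sub>v col V k) $ i" using V i k by simp
    finally show "col (transpose_mat X * U) k $ i = (S $$ (k,k) \<cdot>\<^sub>v col V k) $ i" .
  qed (use XU V in auto)
  finally show "transpose_mat X *\<^sub>v col U k = S $$ (k,k) \<cdot>\<^sub>v col V k" .
qed

text \<open>The contributions of \<open>U'\<close> and \<open>V'\<close> to the derivative of \<open>u\<^sub>k \<bullet> X v\<^sub>k\<close> are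
  \<open>\<sigma>\<^sub>k (u\<^sub>k' \<bullet> u\<^sub>k)\<close> and \<open>\<sigma>\<^sub>k (v\<^sub>k \<bullet> v\<^sub>k')\<close>, which vanish because the columns stay normalised.\<close>

lemma singular_value_derivative:
  assumes U: "has_mat_derivative m m U U' t" and V: "has_mat_derivative n n V V' t"
    and X: "has_mat_derivative m n X X' t"
    and S: "\<And>s. s \<ge> 0 \<Longrightarrow> S s \<in> carrier_mat m n"
    and Uo: "\<And>s. s \<ge> 0 \<Longrightarrow> transpose_mat (U s) * U s = 1\<^sub>m m"
    and Vo: "\<And>s. s \<ge> 0 \<Longrightarrow> transpose_mat (V s) * V s = 1\<^sub>m n"
    and diag: "\<And>s i j. s \<ge> 0 \<Longrightarrow> i < m \<Longrightarrow> j < n \<Longrightarrow> i \<noteq> j \<Longrightarrow> S s $$ (i,j) = 0"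
    and svd: "\<And>s. s \<ge> 0 \<Longrightarrow> X s = U s * S s * transpose_mat (V s)"
    and k: "k < min m n"
  shows "((\<lambda>s. S s $$ (k,k)) has_real_derivative col (U t) k \<bullet> (X' *\<^sub>v col (V t) k)) (at t within {0..})"
proof -
  have t: "t \<ge> 0" using U by (simp add: has_mat_derivative_def)
  have km: "k < m" and kn: "k < n" using k by auto
  have cU: "U s \<in> carrier_mat m m" and cV: "V s \<in> carrier_mat n n" and cX: "X s \<in> carrier_mat m n"
    if "s \<ge> 0" for s
    using U V X that by (auto simp: has_mat_derivative_def)
  have c': "U' \<in> carrier_mat m m" "V' \<in> carrier_mat n n" "X' \<in> carrier_mat m n"
    using U V X by (auto simp: has_mat_derivative_def)
  note c = c' cU[OF t] cV[OF t] cX[OF t]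
  have sv: "X s *\<^sub>v col (V s) k = S s $$ (k,k) \<cdot>\<^sub>v col (U s) k"
      "transpose_mat (X s) *\<^sub>v col (U s) k = S s $$ (k,k) \<cdot>\<^sub>v col (V s) k"
      "transpose_mat (U s) * (X s * V s) = S s" if s: "s \<ge> 0" for s
    using svd_singular_vectors[OF cU[OF s] S[OF s] cV[OF s] Uo[OF s] Vo[OF s] diag[OF s] svd[OF s] k]
    by simp_all
  let ?u = "col (U t) k" and ?v = "col (V t) k" and ?\<sigma> = "S t $$ (k,k)"
  have u: "?u \<in> carrier_vec m" and v: "?v \<in> carrier_vec n"
    and u': "col U' k \<in> carrier_vec m" and v': "col V' k \<in> carrier_vec n"
    using c by (auto simp: carrier_vecI)
  \<comment> \<open>The product rule applied to U^T (X V), whose \<open>(k,k)\<close> entry is the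
    singular value.\<close>
  define E where "E = transpose_mat U' * (X t * V t) + transpose_mat (U t) * (X' * V t + X t * V')"
  have "has_mat_derivative m n (\<lambda>s. transpose_mat (U s) * (X s * V s)) E t"
    unfolding E_def
    by (rule has_mat_derivative_mult[OF has_mat_derivative_transpose[OF U] has_mat_derivative_mult[OF X V]])
  from has_mat_derivativeD[OF this km kn]
  have "((\<lambda>s. S s $$ (k,k)) has_real_derivative E $$ (k,k)) (at t within {0..})"
    by (rule has_field_derivative_transform_within[where d = 1]) (use t sv(3) in auto)
  moreover have "E $$ (k,k) = ?u \<bullet> (X' *\<^sub>v ?v)"
  proof -
    have col_mult: "col (A * B) k = A *\<^sub>v col B k"
      if "A \<in> carrier_mat m n" "B \<in> carrier_mat n n" for A B :: "real mat"
      using that kn by (intro eq_vecI) auto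
    have "E $$ (k,k) = col U' k \<bullet> col (X t * V t) k + ?u \<bullet> col (X' * V t + X t * V') k"
      using c km kn by (simp add: E_def)
    also have "col (X t * V t) k = ?\<sigma> \<cdot>\<^sub>v ?u"
      using col_mult[of "X t" "V t"] sv(1)[OF t] c by simp
    also have "col (X' * V t + X t * V') k = X' *\<^sub>v ?v + X t *\<^sub>v col V' k"
    proof -
      have "col (X' * V t + X t * V') k = col (X' * V t) k + col (X t * V') k"
        using c kn by (intro eq_vecI) auto
      then show ?thesis using col_mult[of X' "V t"] col_mult[of "X t" V'] c by simp
    qed
    also have "?u \<bullet> (X' *\<^sub>v ?v + X t *\<^sub>v col V' k) = ?u \<bullet> (X' *\<^sub>v ?v) + ?u \<bullet> (X t *\<^sub>v col V' k)"
      using c u v v' by (intro scalar_prod_add_distrib[of _ m]) (auto intro!: mult_mat_vec_carrier)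
    also have "?u \<bullet> (X t *\<^sub>v col V' k) = (transpose_mat (X t) *\<^sub>v ?u) \<bullet> col V' k"
      using transpose_vec_mult_scalar[OF cX[OF t] v' u] by simp
    also have "\<dots> = ?\<sigma> * (?v \<bullet> col V' k)"
      using sv(2)[OF t] v v' by simp
    also have "?v \<bullet> col V' k = 0"
      using orthonormal_col_derivative[OF V Vo kn] comm_scalar_prod[OF v v'] by simp
    also have "col U' k \<bullet> (?\<sigma> \<cdot>\<^sub>v ?u) = 0"
      using orthonormal_col_derivative[OF U Uo km] u u' by simp
    finally show ?thesis by simp
  qed
  ultimately show ?thesis by simp
qed

text \<open>For the full product the Gram identities read X X^T = A^L and X^T X = B^L, so
  \<open>u\<close> and \<open>v\<close> are eigenvectors of these powers with eigenvalue \<sigma>^2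
  = \<mu>^L. Positive semidefiniteness of \<open>A\<close> and \<open>B\<close> permits passing to
  the L-th root.\<close>

lemma balanced_end_to_end_eigenvectors:
  assumes Ws: "\<And>l. l < L \<Longrightarrow> Ws l \<in> carrier_mat (d (Suc l)) (d l)"
    and bal: "\<And>l. l + 2 \<le> L \<Longrightarrow> transpose_mat (Ws (Suc l)) * Ws (Suc l) = Ws l * transpose_mat (Ws l)"
    and L: "0 < L" and u: "u \<in> carrier_vec (d L)" and v: "v \<in> carrier_vec (d 0)" and \<mu>: "\<mu> \<ge> 0"
    and Xv: "prod_layers Ws (d 0) L *\<^sub>v v = \<sigma> \<cdot>\<^sub>v u"
    and Xu: "transpose_mat (prod_layers Ws (d 0) L) *\<^sub>v u = \<sigma> \<cdot>\<^sub>v v"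
    and \<sigma>: "\<mu> ^ L = \<sigma>\<^sup>2"
  shows "(Ws (L - 1) * transpose_mat (Ws (L - 1))) *\<^sub>v u = \<mu> \<cdot>\<^sub>v u"
    and "(transpose_mat (Ws 0) * Ws 0) *\<^sub>v v = \<mu> \<cdot>\<^sub>v v"
proof -
  define X where "X = prod_layers Ws (d 0) L"
  have X: "X \<in> carrier_mat (d L) (d 0)" using prod_layers_carrier[of L Ws d L] Ws by (simp add: X_def)
  have XR: "X = layers_above Ws (d L) L L"
    using prod_layers_split[of L Ws d 0] layers_above_carrier[of L Ws d 0] Ws by (simp add: X_def)
  have "(X * transpose_mat X) *\<^sub>v u = X *\<^sub>v (\<sigma> \<cdot>\<^sub>v v)"
    using X u Xu by (simp add: mat_vec_assoc_dim X_def)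
  also have "\<dots> = \<mu> ^ L \<cdot>\<^sub>v u"
    using mult_mat_vec[OF X v] Xv by (simp add: X_def[symmetric] smult_smult_assoc \<sigma> power2_eq_square)
  finally have "(Ws (L - 1) * transpose_mat (Ws (L - 1))) ^\<^sub>m L *\<^sub>v u = \<mu> ^ L \<cdot>\<^sub>v u"
    using balanced_suffix_gram[of L Ws d L] Ws bal L by (simp add: XR)
  moreover have "Ws (L - 1) \<in> carrier_mat (d L) (d (L - 1))" using Ws[of "L - 1"] L by simp
  ultimately show "(Ws (L - 1) * transpose_mat (Ws (L - 1))) *\<^sub>v u = \<mu> \<cdot>\<^sub>v u"
    using gram_power_eigenvector u \<mu> L by blast
  have XT: "transpose_mat X \<in> carrier_mat (d 0) (d L)" using X by simp
  have "(transpose_mat X * X) *\<^sub>v v = transpose_mat X *\<^sub>v (\<sigma> \<cdot>\<^sub>v u)"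
    using X v Xv by (simp add: mat_vec_assoc_dim X_def)
  also have "\<dots> = \<mu> ^ L \<cdot>\<^sub>v v"
    using mult_mat_vec[OF XT u] Xu by (simp add: X_def[symmetric] smult_smult_assoc \<sigma> power2_eq_square)
  \<comment> \<open>The double transpose displays \<open>B\<close> as M M^T with M = W_0^T, the form
    expected by \<open>gram_power_eigenvector\<close>.\<close>
  finally have "(transpose_mat (Ws 0) * transpose_mat (transpose_mat (Ws 0))) ^\<^sub>m L *\<^sub>v v = \<mu> ^ L \<cdot>\<^sub>v v"
    using balanced_prefix_gram[of L Ws d L] Ws bal L by (simp add: X_def)
  moreover have "transpose_mat (Ws 0) \<in> carrier_mat (d 0) (d (Suc 0))" using Ws[of 0] L by simp
  ultimately have "(transpose_mat (Ws 0) * transpose_mat (transpose_mat (Ws 0))) *\<^sub>v v = \<mu> \<cdot>\<^sub>v v"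
    using gram_power_eigenvector v \<mu> L by blast
  then show "(transpose_mat (Ws 0) * Ws 0) *\<^sub>v v = \<mu> \<cdot>\<^sub>v v" by simp
qed

lemma frob_inner_outer_prod:
  assumes "G \<in> carrier_mat m n" "u \<in> carrier_vec m" "v \<in> carrier_vec n"
  shows "frob_inner G (outer_prod u v) = u \<bullet> (G *\<^sub>v v)"
  using assms unfolding frob_inner_def outer_prod_def
  by (auto intro!: sum.cong simp: scalar_prod_def lessThan_atLeast0 sum_distrib_left algebra_simps)

lemma powr_root_power:
  fixes \<sigma> :: real
  assumes "L \<ge> 2" "\<sigma> \<ge> 0"
  shows "((\<sigma>\<^sup>2) powr (1 / real L)) ^ L = \<sigma>\<^sup>2"
    and "((\<sigma>\<^sup>2) powr (1 / real L)) ^ (L - 1) = (\<sigma>\<^sup>2) powr (1 - 1 / real L)"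
    and "(\<sigma>\<^sup>2) powr (1 - 1 / real L) * \<sigma> = (\<sigma>\<^sup>2) powr (3 / 2 - 1 / real L)"
proof -
  define x where "x = \<sigma>\<^sup>2"
  have x: "x \<ge> 0" by (simp add: x_def)
  \<comment> \<open>At x = 0 the right side is 0 for every exponent, while the left side would be 1
    for N = 0; hence \<open>N > 0\<close>, which \<open>L \<ge> 2\<close> provides for
    \<open>N = L - 1\<close>.\<close>
  have pow: "(x powr (1 / real L)) ^ N = x powr (real N / real L)" if "N > 0" for N
  proof (cases "x = 0")
    case False
    then have "(x powr (1 / real L)) ^ N = (x powr (1 / real L)) powr real N"
      by (subst powr_realpow) auto
    then show ?thesis by (simp only: powr_powr) simp
  qed (use that in simp)
  show "((\<sigma>\<^sup>2) powr (1 / real L)) ^ L = \<sigma>\<^sup>2"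
    using pow[of L] assms x by (simp only: x_def[symmetric]) simp
  have "real (L - 1) / real L = 1 - 1 / real L"
    using assms by (simp add: of_nat_diff diff_divide_distrib)
  then show "((\<sigma>\<^sup>2) powr (1 / real L)) ^ (L - 1) = (\<sigma>\<^sup>2) powr (1 - 1 / real L)"
    using pow[of "L - 1"] assms by (simp only: x_def[symmetric])
  \<comment> \<open>Nonnegativity of \<sigma> makes it the square root of \<open>x\<close>, so an
    extra factor \<sigma> raises the exponent by 1/2.\<close>
  have "x powr (1 / 2) = \<sigma>" using x assms by (simp add: powr_half_sqrt x_def)
  then have "x powr (1 - 1 / real L) * \<sigma> = x powr (1 - 1 / real L) * x powr (1 / 2)"
    by (simp only:)
  also have "\<dots> = x powr (1 - 1 / real L + 1 / 2)" by (rule powr_add[symmetric])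
  also have "1 - 1 / real L + 1 / 2 = 3 / 2 - 1 / real L" by simp
  finally show "(\<sigma>\<^sup>2) powr (1 - 1 / real L) * \<sigma> = (\<sigma>\<^sup>2) powr (3 / 2 - 1 / real L)"
    by (simp only: x_def)
qed

theorem theorem1:
  fixes m n L :: nat and d :: "nat \<Rightarrow> nat"
    and W :: "nat \<Rightarrow> real \<Rightarrow> real mat"
    and LY :: "real mat \<Rightarrow> real" and lr lc :: real
    and Wr Wc :: "real mat"
    and U S V :: "real \<Rightarrow> real mat"
    and k :: nat and t :: real
  assumes mn: "m \<ge> 1" "n \<ge> 1" and L2: "L \<ge> 2"
    and d0: "d 0 = n" and dL: "d L = m" and dpos: "\<And>l. 0 < l \<Longrightarrow> l < L \<Longrightarrow> d l \<ge> 1"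
    and Wdim: "\<And>l s. l < L \<Longrightarrow> s \<ge> 0 \<Longrightarrow> W l s \<in> carrier_mat (d (Suc l)) (d l)"
    and balanced: "\<And>l. l + 2 \<le> L \<Longrightarrow>
        transpose_mat (W (Suc l) 0) * W (Suc l) 0 = W l 0 * transpose_mat (W l 0)"
    and LY_analytic: "analytic_mat_fun m n LY"
    and lam: "lr \<ge> 0" "lc \<ge> 0"
    and Wr: "Wr \<in> carrier_mat m m" and Wc: "Wc \<in> carrier_mat n n"
    and flow: "\<And>l s i j. l < L \<Longrightarrow> s \<ge> 0 \<Longrightarrow> i < d (Suc l) \<Longrightarrow> j < d l \<Longrightarrow>
        ((\<lambda>\<tau>. W l \<tau> $$ (i,j)) has_real_derivative
           - (grad_mat (\<lambda>M. reg_loss LY lr lc (adaptive_laplacian m Wr) (adaptive_laplacian n Wc)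
                    (prod_layers (\<lambda>q. if q = l then M else W q s) n L)) (W l s)) $$ (i,j))
         (at s within {0..})"
    and U_dim: "\<And>s. s \<ge> 0 \<Longrightarrow> U s \<in> carrier_mat m m"
    and S_dim: "\<And>s. s \<ge> 0 \<Longrightarrow> S s \<in> carrier_mat m n"
    and V_dim: "\<And>s. s \<ge> 0 \<Longrightarrow> V s \<in> carrier_mat n n"
    and U_orth: "\<And>s. s \<ge> 0 \<Longrightarrow> transpose_mat (U s) * U s = 1\<^sub>m m"
    and V_orth: "\<And>s. s \<ge> 0 \<Longrightarrow> transpose_mat (V s) * V s = 1\<^sub>m n"
    and S_diag: "\<And>s i j. s \<ge> 0 \<Longrightarrow> i < m \<Longrightarrow> j < n \<Longrightarrow> i \<noteq> j \<Longrightarrow> S s $$ (i,j) = 0"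
    and S_nonneg: "\<And>s i. s \<ge> 0 \<Longrightarrow> i < min m n \<Longrightarrow> S s $$ (i,i) \<ge> 0"
    and svd: "\<And>s. s \<ge> 0 \<Longrightarrow> prod_layers (\<lambda>q. W q s) n L = U s * S s * transpose_mat (V s)"
    and U_an: "\<And>i j. i < m \<Longrightarrow> j < m \<Longrightarrow> analytic_on_nonneg (\<lambda>s. U s $$ (i,j))"
    and S_an: "\<And>i j. i < m \<Longrightarrow> j < n \<Longrightarrow> analytic_on_nonneg (\<lambda>s. S s $$ (i,j))"
    and V_an: "\<And>i j. i < n \<Longrightarrow> j < n \<Longrightarrow> analytic_on_nonneg (\<lambda>s. V s $$ (i,j))"
    and k: "k < min m n" and t: "t \<ge> 0"
  shows
    "let Lr = adaptive_laplacian m Wr; Lc = adaptive_laplacian n Wc;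
         \<sigma> = S t $$ (k,k); u = col (U t) k; v = col (V t) k;
         X = prod_layers (\<lambda>q. W q t) n L;
         \<gamma> = lr * (u \<bullet> (Lr *\<^sub>v u)) + lc * (v \<bullet> (Lc *\<^sub>v v))
     in ((\<lambda>s. S s $$ (k,k)) has_real_derivative
           (- real L * (\<sigma>\<^sup>2) powr (1 - 1 / real L) * frob_inner (grad_mat LY X) (outer_prod u v)
            - 2 * real L * (\<sigma>\<^sup>2) powr (3 / 2 - 1 / real L) * \<gamma>))
          (at t within {0..})
        \<and> \<gamma> \<ge> 0"
proof -
  define Lr where "Lr = adaptive_laplacian m Wr"
  define Lc where "Lc = adaptive_laplacian n Wc"
  define \<sigma> where "\<sigma> = S t $$ (k,k)"
  define u where "u = col (U t) k"
  define v where "v = col (V t) k"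
  define X where "X s = prod_layers (\<lambda>q. W q s) n L" for s
  \<comment> \<open>The gradient of the regularised loss at \<open>X s\<close>; the factors 2 come
    from the symmetric quadratic terms.\<close>
  define G where "G s = grad_mat LY (X s) + (2 * lr) \<cdot>\<^sub>m (Lr * X s) + (2 * lc) \<cdot>\<^sub>m (X s * Lc)" for s
  define \<gamma> where "\<gamma> = lr * (u \<bullet> (Lr *\<^sub>v u)) + lc * (v \<bullet> (Lc *\<^sub>v v))"
  have Lr: "Lr \<in> carrier_mat m m" "transpose_mat Lr = Lr"
    and Lc: "Lc \<in> carrier_mat n n" "transpose_mat Lc = Lc"
    by (simp_all add: Lr_def Lc_def adaptive_laplacian_carrier adaptive_laplacian_sym)
  have X: "X s \<in> carrier_mat m n" if "s \<ge> 0" for s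
    using prod_layers_carrier[of L "\<lambda>q. W q s" d L] Wdim that d0 dL by (simp add: X_def)
  have gradc: "grad_mat LY (X s) \<in> carrier_mat m n" if "s \<ge> 0" for s
    using X[OF that] by (simp add: grad_mat_def)
  have G: "G s \<in> carrier_mat m n" if "s \<ge> 0" for s
    using X[OF that] gradc[OF that] Lr Lc by (auto simp: G_def intro!: add_carrier_mat mult_carrier_mat)
  have field: "has_mat_derivative (d (Suc l)) (d l) (W l) (layer_flow_field (\<lambda>q. W q s) d L (G s) l) s"
    if l: "l < L" and s: "s \<ge> 0" for l s
  proof -
    let ?g = "grad_mat (\<lambda>M. reg_loss LY lr lc Lr Lc
      (prod_layers (\<lambda>q. if q = l then M else W q s) n L)) (W l s)"
    have "?g = - layer_flow_field (\<lambda>q. W q s) d L (G s) l"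
    proof -
      have "?g = transpose_mat (layers_above (\<lambda>q. W q s) (d L) L (L - Suc l)) * G s
          * transpose_mat (prod_layers (\<lambda>q. W q s) (d 0) l)"
        unfolding d0[symmetric]
      proof (rule grad_mat_prod_layers[of L "\<lambda>q. W q s"])
        fix H :: "real mat" assume "H \<in> carrier_mat (d L) (d 0)"
        then have "H \<in> carrier_mat m n" by (simp add: d0 dL)
        from reg_loss_directional_derivative[OF LY_analytic X[OF s] this Lr Lc, of lr lc]
        show "((\<lambda>h. reg_loss LY lr lc Lr Lc (prod_layers (\<lambda>q. W q s) (d 0) L + h \<cdot>\<^sub>m H))
          has_real_derivative frob_inner (G s) H) (at 0)"
          by (simp add: G_def X_def d0)
      qed (use Wdim l s G d0 dL in auto)
      then show ?thesis by (simp add: layer_flow_field_def)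
    qed
    moreover have "?g \<in> carrier_mat (d (Suc l)) (d l)"
      using Wdim[OF l s] by (simp add: grad_mat_def)
    ultimately have f: "layer_flow_field (\<lambda>q. W q s) d L (G s) l = - ?g" "?g \<in> carrier_mat (d (Suc l)) (d l)"
      by auto
    show ?thesis
      unfolding has_mat_derivative_def f(1)
      using Wdim[OF l] s f(2) flow[OF l s] by (auto simp: Lr_def Lc_def)
  qed
  \<comment> \<open>Balancedness at time \<open>t\<close>, propagated from time 0 by the
    flow.\<close>
  have bal: "transpose_mat (W (Suc l) t) * W (Suc l) t = W l t * transpose_mat (W l t)" if "l + 2 \<le> L" for l
  proof (rule balanced_conserved[where G = G])
    show "G s \<in> carrier_mat (d L) (d 0)" if "s \<ge> 0" for s using G[OF that] by (simp add: d0 dL)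
  qed (use field balanced[OF that] that t in auto)
  have km: "k < m" and kn: "k < n" using k by auto
  have u: "u \<in> carrier_vec m" and v: "v \<in> carrier_vec n"
    using U_dim[OF t] V_dim[OF t] by (auto simp: u_def v_def carrier_vecI)
  have \<sigma>: "\<sigma> \<ge> 0" using S_nonneg[OF t k] by (simp add: \<sigma>_def)
  have svdX: "X s = U s * S s * transpose_mat (V s)" if "s \<ge> 0" for s using svd[OF that] by (simp add: X_def)
  note sv = svd_singular_vectors[OF U_dim[OF t] S_dim[OF t] V_dim[OF t] U_orth[OF t] V_orth[OF t]
      S_diag[OF t] svdX[OF t] k, folded u_def v_def \<sigma>_def]
  \<comment> \<open>The common eigenvalue of the two outer Gram matrices, the nonnegative L-th root
    of \<sigma>^2; since \<open>powr\<close> is 0 at base 0, vanishing singular values are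
    covered.\<close>
  define \<mu> where "\<mu> = (\<sigma>\<^sup>2) powr (1 / real L)"
  have \<mu>: "\<mu> \<ge> 0" "\<mu> ^ L = \<sigma>\<^sup>2" using powr_root_power(1)[OF L2 \<sigma>] by (simp_all add: \<mu>_def)
  have ud: "u \<in> carrier_vec (d L)" and vd: "v \<in> carrier_vec (d 0)" and Gd: "G t \<in> carrier_mat (d L) (d 0)"
    using u v G[OF t] by (simp_all add: d0 dL)
  have Xv: "prod_layers (\<lambda>q. W q t) (d 0) L *\<^sub>v v = \<sigma> \<cdot>\<^sub>v u"
    and Xu: "transpose_mat (prod_layers (\<lambda>q. W q t) (d 0) L) *\<^sub>v u = \<sigma> \<cdot>\<^sub>v v"
    using sv(1,2) by (simp_all add: X_def d0)
  have L0: "0 < L" using L2 by simp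
  note eig = balanced_end_to_end_eigenvectors[of L "\<lambda>q. W q t" d, OF Wdim[OF _ t] bal L0 ud vd \<mu>(1) Xv Xu \<mu>(2)]
  have Au: "(W (L - 1) t * transpose_mat (W (L - 1) t)) *\<^sub>v u = \<mu> \<cdot>\<^sub>v u"
    by (rule eig(1))
  have Bv: "(transpose_mat (W 0 t) * W 0 t) *\<^sub>v v = \<mu> \<cdot>\<^sub>v v"
    by (rule eig(2))
  define X' where "X' = prod_layers_deriv (\<lambda>q. W q t) (layer_flow_field (\<lambda>q. W q t) d L (G t)) n L"
  have dX: "has_mat_derivative m n X X' t"
    using has_mat_derivative_prod_layers[of L d W, OF field[OF _ t] t order_refl]
    by (simp add: X_def[abs_def] X'_def d0 dL)
  have X'c: "X' \<in> carrier_mat m n" using dX by (simp add: has_mat_derivative_def)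
  have flow_val: "u \<bullet> (X' *\<^sub>v v) = - (real L * \<mu> ^ (L - 1) * (u \<bullet> (G t *\<^sub>v v)))"
    using layer_flow_bilinear(1)[of L "\<lambda>q. W q t" d, OF Wdim[OF _ t] bal Gd ud vd Au Bv order_refl] X'c
    by (simp add: d0 dL X'_def[symmetric])
  \<comment> \<open>Analyticity of the decomposition supplies derivatives of the singular vectors,
    also where singular values vanish or coincide.\<close>
  obtain U' where dU: "has_mat_derivative m m U U' t"
    using analytic_has_mat_derivative[of U m m t] U_dim U_an t by blast
  obtain V' where dV: "has_mat_derivative n n V V' t"
    using analytic_has_mat_derivative[of V n n t] V_dim V_an t by blast
  have der: "((\<lambda>s. S s $$ (k,k)) has_real_derivative u \<bullet> (X' *\<^sub>v v)) (at t within {0..})"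
    unfolding u_def v_def
    by (rule singular_value_derivative[OF dU dV dX S_dim U_orth V_orth S_diag svdX k])
  \<comment> \<open>By X v = \<sigma> u and X^T u = \<sigma> v, each regulariser contributes its
    quadratic form times \<sigma>. This extra \<sigma> turns the exponent 1 - 1/L into 3/2 -
    1/L.\<close>
  have Gv: "u \<bullet> (G t *\<^sub>v v) = frob_inner (grad_mat LY (X t)) (outer_prod u v) + 2 * \<sigma> * \<gamma>"
  proof -
    have c: "Lr * X t \<in> carrier_mat m n" "X t * Lc \<in> carrier_mat m n" using Lr Lc X[OF t] by auto
    have c2: "grad_mat LY (X t) *\<^sub>v v \<in> carrier_vec m" "(Lr * X t) *\<^sub>v v \<in> carrier_vec m"
      "(X t * Lc) *\<^sub>v v \<in> carrier_vec m" "Lr *\<^sub>v u \<in> carrier_vec m" "Lc *\<^sub>v v \<in> carrier_vec n"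
      using c gradc[OF t] u v Lr Lc by (auto intro!: mult_mat_vec_carrier)
    have smv: "(a \<cdot>\<^sub>m A) *\<^sub>v v = a \<cdot>\<^sub>v (A *\<^sub>v v)" if "A \<in> carrier_mat m n" for a A
      using that v by (intro eq_vecI) auto
    have "G t *\<^sub>v v = grad_mat LY (X t) *\<^sub>v v + (2 * lr) \<cdot>\<^sub>v ((Lr * X t) *\<^sub>v v) + (2 * lc) \<cdot>\<^sub>v ((X t * Lc) *\<^sub>v v)"
      unfolding G_def using c gradc[OF t] v
      by (simp add: add_mult_distrib_mat_vec[of _ m n] smv del: assoc_add_mat assoc_mult_mat_vec)
    then have "u \<bullet> (G t *\<^sub>v v) = u \<bullet> (grad_mat LY (X t) *\<^sub>v v)
        + 2 * lr * (u \<bullet> ((Lr * X t) *\<^sub>v v)) + 2 * lc * (u \<bullet> ((X t * Lc) *\<^sub>v v))"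
      using c2 u by (simp add: scalar_prod_add_distrib[of _ m] del: assoc_mult_mat_vec)
    moreover have "u \<bullet> ((Lr * X t) *\<^sub>v v) = \<sigma> * (u \<bullet> (Lr *\<^sub>v u))"
    proof -
      have "(Lr * X t) *\<^sub>v v = \<sigma> \<cdot>\<^sub>v (Lr *\<^sub>v u)"
        using Lr X[OF t] v sv(1) mult_mat_vec[OF Lr(1) u] by (simp add: mat_vec_assoc_dim)
      then show ?thesis using c2 u by simp
    qed
    moreover have "u \<bullet> ((X t * Lc) *\<^sub>v v) = \<sigma> * (v \<bullet> (Lc *\<^sub>v v))"
    proof -
      have "(X t * Lc) *\<^sub>v v = X t *\<^sub>v (Lc *\<^sub>v v)"
        using Lc X[OF t] v by (simp add: mat_vec_assoc_dim)
      then have "u \<bullet> ((X t * Lc) *\<^sub>v v) = (transpose_mat (X t) *\<^sub>v u) \<bullet> (Lc *\<^sub>v v)"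
        using transpose_vec_mult_scalar[OF X[OF t] c2(5) u] by simp
      then show ?thesis using sv(2) c2 v by simp
    qed
    ultimately show ?thesis
      by (simp add: frob_inner_outer_prod[OF gradc[OF t] u v] \<gamma>_def algebra_simps)
  qed
  have "u \<bullet> (X' *\<^sub>v v) = - real L * (\<sigma>\<^sup>2) powr (1 - 1 / real L) * frob_inner (grad_mat LY (X t)) (outer_prod u v)
            - 2 * real L * ((\<sigma>\<^sup>2) powr (1 - 1 / real L) * \<sigma>) * \<gamma>"
    unfolding flow_val Gv \<mu>_def powr_root_power(2)[OF L2 \<sigma>] by (simp add: algebra_simps)
  then have val: "u \<bullet> (X' *\<^sub>v v) = - real L * (\<sigma>\<^sup>2) powr (1 - 1 / real L) * frob_inner (grad_mat LY (X t)) (outer_prod u v)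
            - 2 * real L * (\<sigma>\<^sup>2) powr (3 / 2 - 1 / real L) * \<gamma>"
    unfolding powr_root_power(3)[OF L2 \<sigma>] .
  have "\<gamma> \<ge> 0"
    using adaptive_laplacian_psd[OF u, of Wr] adaptive_laplacian_psd[OF v, of Wc] lam
    by (simp add: \<gamma>_def Lr_def Lc_def)
  then show ?thesis
    unfolding Let_def using der[unfolded val]
    by (simp add: \<gamma>_def Lr_def Lc_def \<sigma>_def u_def v_def X_def)
qed

end
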